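(* Let $d$ be a positive integer and let $f\colon\mathbb{R}^d\to[0,\infty)$ be an upper semi-continuous log-concave function of finite positive integral. Then the Löwner $s$-functions ${}^{(s)}L_f$ of $f$ converge uniformly on $\mathbb{R}^d$ to ${}^{(0)}L_f$ as $s\to+0$.
   Context: $|\cdot|$ denotes the Euclidean norm. A function $f\colon\mathbb{R}^d\to[0,\infty)$ is log-concave if $f=e^{-\varphi}$ for a convex function $\varphi\colon\mathbb{R}^d\to\mathbb{R}\cup\{+\infty\}$ (with $e^{-\infty}=0$). The relation $f_1\le f_2$ means $f_1(x)\le f_2(x)$ for all $x\in\mathbb{R}^d$. The function $\psi_s\colon[0,\infty)\to[0,\infty)$ is defined by $\psi_0(t)=t$ and, for $s\in(0,\infty)$, $$\psi_s(t)=\frac{s}{2}\left[\sqrt{1+4\left(\tfrac{t}{s}\right)^2}-\ln\left(\frac{1+\sqrt{1+4(t/s)^2}}{2}\right)-1\right].$$ $\mathcal{E}^d[\psi_s]$ is the class of functions on $\mathbb{R}^d$ of the form $x\mapsto\alpha e^{-\psi_s(|A(x-a)|)}$ with $A\in\mathrm{GL}(d)$, $\alpha>0$, $a\in\mathbb{R}^d$. For $s\in[0,\infty)$, the Löwner $s$-function ${}^{(s)}L_f$ of $f$ is the (existing and unique) function $\ell\in\mathcal{E}^d[\psi_s]$ that minimizes $\int_{\mathbb{R}^d}\ell$ subject to $f\le\ell$. (The function ${}^{(0)}L_f$, i.e. the minimizer among functions $\alpha e^{-|A(x-a)|}$, is what is called the Löwner function of $f$ in the sense of Li, Schütt and Werner.)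 *)

theory Defs
  imports "HOL-Analysis.Analysis"
begin

definition upper_semicontinuous :: "('a::topological_space \<Rightarrow> real) \<Rightarrow> bool" where
  "upper_semicontinuous f \<longleftrightarrow> (\<forall>x y. f x < y \<longrightarrow> (\<forall>\<^sub>F z in nhds x. f z < y))"

text \<open>The library's \<open>convex_on\<close> is restricted to real-valued functions.  The coefficients
  below may be 0; with \<open>0 * \<infinity> = 0\<close> the inequality is then trivial.\<close>

definition ereal_convex :: "('a::real_vector \<Rightarrow> ereal) \<Rightarrow> bool" where
  "ereal_convex \<phi> \<longleftrightarrow>
     (\<forall>x. \<phi> x \<noteq> - \<infinity>) \<and>
     (\<forall>x y. \<forall>u\<ge>0. \<forall>v\<ge>0. u + v = 1 \<longrightarrow>
        \<phi> (u *\<^sub>R x + v *\<^sub>R y) \<le> ereal u * \<phi> x + ereal v * \<phi> y)"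

text \<open>\<open>exp (- u)\<close> for \<open>u\<close> in \<open>\<real> \<union> {+\<infinity>}\<close>; the value at \<open>u = - \<infinity>\<close> is irrelevant.\<close>

definition exp_minus_ereal :: "ereal \<Rightarrow> real" where
  "exp_minus_ereal u = (if u = \<infinity> then 0 else exp (- real_of_ereal u))"

definition log_concave :: "('a::real_vector \<Rightarrow> real) \<Rightarrow> bool" where
  "log_concave f \<longleftrightarrow> (\<exists>\<phi>. ereal_convex \<phi> \<and> (\<forall>x. f x = exp_minus_ereal (\<phi> x)))"

text \<open>Only used for \<open>s \<ge> 0\<close> and \<open>t \<ge> 0\<close>.\<close>

definition psi :: "real \<Rightarrow> real \<Rightarrow> real" where
  "psi s t = (if s = 0 then t else
     s / 2 * (sqrt (1 + 4 * (t / s)\<^sup>2) - ln ((1 + sqrt (1 + 4 * (t / s)\<^sup>2)) / 2) - 1))"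

definition E_class :: "(real \<Rightarrow> real) \<Rightarrow> (real^'n \<Rightarrow> real) set" where
  "E_class \<psi> = {\<lambda>x. \<alpha> * exp (- \<psi> (norm (A *v (x - a)))) | (A :: real^'n^'n) \<alpha> a.
                  invertible A \<and> \<alpha> > 0}"

text \<open>For \<open>s \<ge> 0\<close> every member of \<open>E_class (psi s)\<close> is integrable, since \<open>psi s\<close> has linear
  growth, so the convention that the integral of a non-integrable function is 0 plays no role.\<close>

definition is_Loewner :: "real \<Rightarrow> (real^'n \<Rightarrow> real) \<Rightarrow> (real^'n \<Rightarrow> real) \<Rightarrow> bool" where
  "is_Loewner s f =
     is_arg_min (\<lambda>l. \<integral>x. l x \<partial>lborel) (\<lambda>l. l \<in> E_class (psi s) \<and> (\<forall>x. f x \<le> l x))"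

definition Loewner :: "real \<Rightarrow> (real^'n \<Rightarrow> real) \<Rightarrow> real^'n \<Rightarrow> real" where
  "Loewner s f = (THE l. is_Loewner s f l)"

end

theory Submission
  imports Defs
begin

text \<open>
  Write a candidate as \<open>\<alpha> exp (- \<psi>\<^sub>s |A x + b|)\<close>; its integral is \<open>\<alpha> / |det A|\<close> up to a factor depending
  only on \<open>s\<close>. A log-concave integrable \<open>f\<close> with positive integral is bounded below on a ball and decays
  exponentially. The lower bound on a ball confines the parameters of all candidates above \<open>f\<close> with
  bounded \<open>\<alpha> / |det A|\<close> and \<open>s\<close> to a compact set, and the condition \<open>f \<le> \<ell>\<close> passes to limits, also when
  \<open>s\<close> varies; this yields minimizers.

  A minimizer is unique. For two of them, simultaneous diagonalization and strict concavity of \<open>log det\<close>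
  show that averaging \<open>A\<close> and \<open>b\<close> would improve the value unless the quadratic forms \<open>|A x|\<^sup>2\<close> agree. If
  they agree, \<open>f\<close> lies below two translates of one profile, hence below their minimum, and a slightly
  wider but lower profile fits above that minimum.

  Since \<open>\<psi>\<^sub>s \<le> \<psi>\<^sub>0\<close>, the minimizer for \<open>s = 0\<close> competes for every \<open>s\<close>, so the values \<open>\<alpha> / |det A|\<close> are bounded
  by the optimal one for \<open>s = 0\<close>. Every limit of parameters along \<open>s \<rightarrow> 0\<close> is therefore optimal for
  \<open>s = 0\<close>, and uniqueness identifies it.
\<close>

subsection \<open>The functions \<open>\<psi>\<^sub>s\<close>\<close>

lemma psi_zero [simp]: "psi 0 t = t"
  by (simp add: psi_def)

lemma psi_at_zero [simp]: "psi s 0 = 0"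
  by (simp add: psi_def)

text \<open>With \<open>w\<close> the square root, \<open>1 - 1 / (1 + w) = w / (1 + w)\<close>
  cancels the factor \<open>1 / w\<close> from the chain rule.\<close>

lemma psi_has_real_derivative:
  assumes "0 < s"
  shows "(psi s has_real_derivative 2 * (t / s) / (1 + sqrt (1 + 4 * (t / s)\<^sup>2))) (at t)"
proof -
  define w where "w = sqrt (1 + 4 * (t / s)\<^sup>2)"
  have p: "0 < 1 + 4 * (t / s)\<^sup>2" by (simp add: add_pos_nonneg)
  have w: "0 < w" unfolding w_def using p by simp
  define W where "W = (\<lambda>t. sqrt (1 + 4 * (t / s)\<^sup>2))"
  have "(W has_real_derivative 4 * (t / s) / w / s) (at t)"
    unfolding W_def w_def using assms p
    by (auto intro!: derivative_eq_intros simp: divide_simps power2_eq_square)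
  moreover have "W t = w" by (simp add: W_def w_def)
  ultimately have "((\<lambda>t. s / 2 * (W t - ln ((1 + W t) / 2) - 1))
      has_real_derivative s / 2 * (4 * (t / s) / w / s - 4 * (t / s) / w / s / (1 + w))) (at t)"
    using w by (auto intro!: derivative_eq_intros simp: add_pos_pos)
  moreover have "s / 2 * (4 * u / w / s - 4 * u / w / s / (1 + w)) = 2 * u / (1 + w)" for u
    using w assms by (simp add: divide_simps) (simp add: algebra_simps)
  moreover have "psi s = (\<lambda>t. s / 2 * (W t - ln ((1 + W t) / 2) - 1))"
    using assms by (simp add: psi_def W_def fun_eq_iff)
  ultimately show ?thesis by (simp only: w_def)
qed

text \<open>For \<open>s > 0\<close> the derivative is nondecreasing: after clearing denominators
  the point is \<open>u * sqrt (1 + 4 * v\<^sup>2) \<le> v * sqrt (1 + 4 * u\<^sup>2)\<close>, which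
  squares to \<open>u\<^sup>2 \<le> v\<^sup>2\<close>.\<close>

lemma convex_on_psi:
  assumes "0 \<le> s"
  shows "convex_on {0..} (psi s)"
proof (cases "s = 0")
  case True
  then show ?thesis by (auto simp: convex_on_def)
next
  case False
  then have s: "0 < s" using assms by simp
  show ?thesis
  proof (rule convex_on_realI)
    fix x y :: real
    assume xy: "x \<in> {0..}" "y \<in> {0..}" "x \<le> y"
    define u v where "u = x / s" and "v = y / s"
    have uv: "0 \<le> u" "u \<le> v" using xy s by (auto simp: u_def v_def divide_right_mono)
    have "u * sqrt (1 + 4 * v\<^sup>2) = sqrt (u\<^sup>2 * (1 + 4 * v\<^sup>2))"
      using uv by (simp add: real_sqrt_mult)
    also have "\<dots> = sqrt (u\<^sup>2 + 4 * (u * v)\<^sup>2)"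
      by (simp add: algebra_simps power_mult_distrib)
    also have "\<dots> \<le> sqrt (v\<^sup>2 + 4 * (u * v)\<^sup>2)"
      using uv by (simp add: power_mono)
    also have "\<dots> = sqrt (v\<^sup>2 * (1 + 4 * u\<^sup>2))"
      by (simp add: algebra_simps power_mult_distrib)
    also have "\<dots> = v * sqrt (1 + 4 * u\<^sup>2)"
      using uv by (simp add: real_sqrt_mult)
    finally have "2 * u * (1 + sqrt (1 + 4 * v\<^sup>2)) \<le> 2 * v * (1 + sqrt (1 + 4 * u\<^sup>2))"
      using uv by (simp add: algebra_simps)
    then show "2 * (x / s) / (1 + sqrt (1 + 4 * (x / s)\<^sup>2)) \<le> 2 * (y / s) / (1 + sqrt (1 + 4 * (y / s)\<^sup>2))"
      unfolding u_def[symmetric] v_def[symmetric]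
      by (simp add: divide_simps add_pos_nonneg add_pos_pos algebra_simps)
  qed (use psi_has_real_derivative s in auto)
qed

lemma sqrt_1_plus_ge:
  shows "2 * u \<le> sqrt (1 + 4 * u\<^sup>2)" and "1 \<le> sqrt (1 + 4 * u\<^sup>2)"
  by (rule real_le_rsqrt, simp add: power_mult_distrib) simp

text \<open>The square root is at most \<open>1 + 2 * u\<close>, and the logarithm is
  nonnegative.\<close>

lemma psi_le:
  assumes "0 \<le> s" "0 \<le> t"
  shows "psi s t \<le> t"
proof (cases "s = 0")
  case False
  then have s: "0 < s" using assms by simp
  define u where "u = t / s"
  have u: "0 \<le> u" using assms by (simp add: u_def)
  have "sqrt (1 + 4 * u\<^sup>2) \<le> 1 + 2 * u"
    using u by (intro real_le_lsqrt) (auto simp: power2_eq_square algebra_simps)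
  moreover have "0 \<le> ln ((1 + sqrt (1 + 4 * u\<^sup>2)) / 2)"
    using sqrt_1_plus_ge(2)[of u] by (intro ln_ge_zero) auto
  ultimately have "s / 2 * (sqrt (1 + 4 * u\<^sup>2) - ln ((1 + sqrt (1 + 4 * u\<^sup>2)) / 2) - 1) \<le> s / 2 * (2 * u)"
    using s by (intro mult_left_mono) linarith+
  then show ?thesis using s by (simp add: psi_def u_def)
qed simp

text \<open>By \<open>ln y \<le> y - 1\<close> at \<open>y = (1 + w) / 2\<close>, the bracket is at
  least \<open>(w - 1) / 2\<close>.\<close>

lemma psi_pos:
  assumes "0 \<le> s" "0 < t"
  shows "0 < psi s t"
proof (cases "s = 0")
  case False
  then have s: "0 < s" using assms by simp
  define u where "u = t / s"
  define w where "w = sqrt (1 + 4 * u\<^sup>2)"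
  have "0 < u" using assms s by (simp add: u_def)
  then have w: "1 < w" unfolding w_def by simp
  then have "ln ((1 + w) / 2) \<le> (1 + w) / 2 - 1"
    by (intro ln_le_minus_one) auto
  then have "0 < w - ln ((1 + w) / 2) - 1" using w by (simp add: field_simps)
  then show ?thesis using s by (simp add: psi_def flip: u_def w_def)
qed (use assms in simp)

lemma psi_nonneg: "0 \<le> s \<Longrightarrow> 0 \<le> t \<Longrightarrow> 0 \<le> psi s t"
  using psi_pos[of s t] by (cases "t = 0") auto

text \<open>The bound \<open>ln y \<le> y - 1\<close> at \<open>y = \<delta> * (1 + w) / 2\<close>
  gives a slope as close to 1 as desired, at the price of an error proportional to \<open>s\<close>
  that vanishes as \<open>s\<close> tends to 0.\<close>

lemma psi_ge:
  assumes "0 \<le> s" "0 \<le> t" "0 < \<delta>" "\<delta> \<le> 1"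
  shows "(1 - \<delta>) * t - s * (1 - ln \<delta>) \<le> psi s t"
proof (cases "s = 0")
  case True
  then show ?thesis using assms by (simp add: algebra_simps)
next
  case False
  then have s: "0 < s" using assms by simp
  define u where "u = t / s"
  define w where "w = sqrt (1 + 4 * u\<^sup>2)"
  have u: "0 \<le> u" using assms s by (simp add: u_def)
  have w: "1 \<le> w" "2 * u \<le> w" unfolding w_def using sqrt_1_plus_ge by auto
  have "ln (\<delta> * ((1 + w) / 2)) \<le> \<delta> * ((1 + w) / 2) - 1"
    using w assms by (intro ln_le_minus_one) auto
  then have ln: "ln ((1 + w) / 2) \<le> \<delta> * ((1 + w) / 2) - 1 - ln \<delta>"
    using w assms by (subst (asm) ln_mult) auto
  have "(1 - \<delta> / 2) * (2 * u) \<le> (1 - \<delta> / 2) * w"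
    using w assms by (intro mult_left_mono) auto
  with ln have 1: "(1 - \<delta> / 2) * (2 * u) - \<delta> / 2 + ln \<delta> \<le> w - ln ((1 + w) / 2) - 1"
    by (simp add: field_simps)
  have "2 * (1 - \<delta>) * u - 2 * (1 - ln \<delta>) \<le> (1 - \<delta> / 2) * (2 * u) - \<delta> / 2 + ln \<delta>"
  proof -
    have "ln \<delta> \<le> 0" using assms by simp
    moreover have "0 \<le> \<delta> * u" using assms u by simp
    ultimately have "ln \<delta> + \<delta> / 2 \<le> \<delta> * u + 2" using assms by linarith
    then show ?thesis by (simp add: algebra_simps)
  qed
  with 1 have "2 * (1 - \<delta>) * u - 2 * (1 - ln \<delta>) \<le> w - ln ((1 + w) / 2) - 1" by simp
  then have "s / 2 * (2 * (1 - \<delta>) * u - 2 * (1 - ln \<delta>)) \<le> s / 2 * (w - ln ((1 + w) / 2) - 1)"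
    using s by (intro mult_left_mono) auto
  then show ?thesis
    using s by (simp add: psi_def field_simps flip: u_def w_def) (simp add: u_def field_simps)
qed

text \<open>At \<open>\<sigma> = 0\<close> the closed formula degenerates, so \<open>psi_le\<close>
  and \<open>psi_ge\<close> squeeze the values there.\<close>

lemma tendsto_psi:
  fixes s t :: "nat \<Rightarrow> real"
  assumes s: "s \<longlonglongrightarrow> \<sigma>" "\<And>n. 0 \<le> s n" and t: "t \<longlonglongrightarrow> \<tau>" "\<And>n. 0 \<le> t n"
  shows "(\<lambda>n. psi (s n) (t n)) \<longlonglongrightarrow> psi \<sigma> \<tau>"
proof (cases "\<sigma> = 0")
  case False
  let ?g = "\<lambda>s t. s / 2 * (sqrt (1 + 4 * (t / s)\<^sup>2) - ln ((1 + sqrt (1 + 4 * (t / s)\<^sup>2)) / 2) - 1)"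
  have ev: "\<forall>\<^sub>F n in sequentially. s n \<noteq> 0"
    using s(1) False by (rule tendsto_imp_eventually_ne)
  have pos: "1 + sqrt (1 + 4 * x\<^sup>2) \<noteq> 0" for x
    using sqrt_1_plus_ge(2)[of x] by linarith
  have "(\<lambda>n. ?g (s n) (t n)) \<longlonglongrightarrow> ?g \<sigma> \<tau>"
    using False pos[of "\<tau> / \<sigma>"] by (intro tendsto_intros s t) auto
  moreover have "\<forall>\<^sub>F n in sequentially. ?g (s n) (t n) = psi (s n) (t n)"
    using ev by eventually_elim (simp add: psi_def)
  moreover have "?g \<sigma> \<tau> = psi \<sigma> \<tau>" using False by (simp add: psi_def)
  ultimately show ?thesis by (auto intro: Lim_transform_eventually)
next
  case True
  have \<tau>: "0 \<le> \<tau>" using t LIMSEQ_le_const by blast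
  show ?thesis
  proof (rule order_tendstoI)
    fix a assume "psi \<sigma> \<tau> < a"
    then have "\<forall>\<^sub>F n in sequentially. t n < a" using True order_tendstoD(2)[OF t(1)] by simp
    then show "\<forall>\<^sub>F n in sequentially. psi (s n) (t n) < a"
      by eventually_elim (use psi_le s(2) t(2) in \<open>meson le_less_trans\<close>)
  next
    fix a assume "a < psi \<sigma> \<tau>"
    then have a: "a < \<tau>" using True by simp
    \<comment> \<open>Small enough that \<open>(1 - \<delta>) * \<tau>\<close> still exceeds
      \<open>a\<close>; the \<open>+ 1\<close> avoids a vanishing denominator.\<close>
    define \<delta> where "\<delta> = min 1 ((\<tau> - a) / (2 * (\<tau> + 1)))"
    have \<delta>: "0 < \<delta>" "\<delta> \<le> 1" using a \<tau> by (auto simp: \<delta>_def)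
    have "\<delta> * (\<tau> + 1) \<le> (\<tau> - a) / (2 * (\<tau> + 1)) * (\<tau> + 1)"
      using \<tau> by (intro mult_right_mono) (auto simp: \<delta>_def)
    also have "\<dots> = (\<tau> - a) / 2" using \<tau> by (simp add: field_simps)
    finally have "a < (1 - \<delta>) * \<tau> - 0 * (1 - ln \<delta>)"
      using a \<delta> by (simp add: algebra_simps)
    moreover have "(\<lambda>n. (1 - \<delta>) * t n - s n * (1 - ln \<delta>)) \<longlonglongrightarrow> (1 - \<delta>) * \<tau> - 0 * (1 - ln \<delta>)"
      using True \<delta> by (intro tendsto_intros s(1)[unfolded True] t)
    ultimately have "\<forall>\<^sub>F n in sequentially. a < (1 - \<delta>) * t n - s n * (1 - ln \<delta>)"
      by (metis order_tendstoD(1))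
    then show "\<forall>\<^sub>F n in sequentially. a < psi (s n) (t n)"
      by eventually_elim (use psi_ge s(2) t(2) \<delta> in \<open>meson less_le_trans\<close>)
  qed
qed

lemma continuous_on_psi_norm:
  assumes "0 \<le> s" "continuous_on UNIV g"
  shows "continuous_on UNIV (\<lambda>x::'a::metric_space. psi s (norm (g x)))"
  unfolding continuous_on_sequentially comp_def
proof safe
  fix x :: "nat \<Rightarrow> 'a" and a assume "x \<longlonglongrightarrow> a"
  then have "(\<lambda>n. g (x n)) \<longlonglongrightarrow> g a"
    using assms(2) by (auto simp: continuous_on_sequentially comp_def)
  then show "(\<lambda>n. psi s (norm (g (x n)))) \<longlonglongrightarrow> psi s (norm (g a))"
    using assms(1) by (intro tendsto_psi tendsto_norm) auto
qed

text \<open>Convexity on the segment from 0 to \<open>u\<close>, with value 0 at 0: the ratio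
  \<open>psi s t / t\<close> is nondecreasing.\<close>

lemma psi_star_shaped:
  assumes "0 \<le> s" "0 \<le> t" "t \<le> u" "0 < u"
  shows "psi s t \<le> t / u * psi s u"
proof -
  have "psi s ((1 - t / u) *\<^sub>R 0 + (t / u) *\<^sub>R u) \<le> (1 - t / u) * psi s 0 + t / u * psi s u"
    using assms by (intro convex_onD[OF convex_on_psi]) (auto simp: field_simps)
  then show ?thesis using assms by simp
qed

lemma psi_mono:
  assumes "0 \<le> s" "0 \<le> t" "t \<le> u"
  shows "psi s t \<le> psi s u"
proof (cases "u = 0")
  case False
  then have u: "0 < u" using assms by simp
  have "psi s t \<le> t / u * psi s u"
    using u assms by (intro psi_star_shaped)
  also have "\<dots> \<le> 1 * psi s u"
    using u assms psi_nonneg[of s u] by (intro mult_right_mono) auto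
  finally show ?thesis by simp
qed (use assms in auto)

text \<open>Since \<open>psi s u / u\<close> is nondecreasing, the increments beyond
  \<open>u\<^sub>0\<close> have at least the chord slope from 0 to \<open>u\<^sub>0\<close>.\<close>

lemma psi_add_ge_slope:
  assumes s: "0 \<le> s" and u: "0 < u\<^sub>0" "u\<^sub>0 \<le> u" and v: "0 \<le> v"
  shows "psi s u + v * (psi s u\<^sub>0 / u\<^sub>0) \<le> psi s (u + v)"
proof -
  have "psi s u\<^sub>0 \<le> u\<^sub>0 / u * psi s u"
    using assms by (intro psi_star_shaped) auto
  then have "psi s u\<^sub>0 / u\<^sub>0 \<le> psi s u / u"
    using u by (simp add: field_simps)
  then have "psi s u + v * (psi s u\<^sub>0 / u\<^sub>0) \<le> psi s u + v * (psi s u / u)"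
    using v by (intro add_left_mono mult_left_mono)
  also have "\<dots> = psi s u * ((u + v) / u)" using u by (simp add: field_simps)
  also have "\<dots> \<le> psi s (u + v)"
  proof -
    have "psi s u \<le> u / (u + v) * psi s (u + v)"
      using assms by (intro psi_star_shaped) auto
    then have "psi s u * ((u + v) / u) \<le> u / (u + v) * psi s (u + v) * ((u + v) / u)"
      using u v by (intro mult_right_mono) auto
    then show ?thesis using u v by simp
  qed
  finally show ?thesis .
qed

lemma psi_superadditive:
  assumes "0 \<le> s" "0 \<le> u" "0 \<le> v"
  shows "psi s u + psi s v \<le> psi s (u + v)"
proof (cases "u = 0 \<or> v = 0")
  case False
  then have pos: "0 < u" "0 < v" using assms by auto
  have "psi s u + psi s v \<le> u / (u + v) * psi s (u + v) + v / (u + v) * psi s (u + v)"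
    using assms pos by (intro add_mono psi_star_shaped) auto
  also have "\<dots> = psi s (u + v)" using pos by (simp flip: distrib_right add_divide_distrib)
  finally show ?thesis .
qed auto

subsection \<open>Singular values\<close>

text \<open>Each new vector maximises \<open>norm (f y)\<close> over the unit sphere of the orthogonal complement of the
  previous ones; varying it in a direction \<open>y\<close> orthogonal to it gives \<open>orthogonal (f e) (f y)\<close>.\<close>

lemma orthonormal_set_orthogonal_image:
  fixes f :: "'a::euclidean_space \<Rightarrow> 'b::real_inner"
  assumes f: "linear f" and "k \<le> DIM('a)"
  shows "\<exists>E. finite E \<and> card E = k \<and> (\<forall>e\<in>E. norm e = 1) \<and> pairwise orthogonal E \<and>
    pairwise (\<lambda>a b. orthogonal (f a) (f b)) E \<and>
    (\<forall>e\<in>E. \<forall>y. (\<forall>e'\<in>E. orthogonal e' y) \<longrightarrow> orthogonal (f e) (f y))"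
  using \<open>k \<le> DIM('a)\<close>
proof (induction k)
  case 0
  show ?case by (intro exI[of _ "{}"]) auto
next
  case (Suc k)
  then obtain E where E: "finite E" "card E = k" "\<forall>e\<in>E. norm e = 1" "pairwise orthogonal E"
    "pairwise (\<lambda>a b. orthogonal (f a) (f b)) E"
    "\<And>e y. e \<in> E \<Longrightarrow> \<forall>e'\<in>E. orthogonal e' y \<Longrightarrow> orthogonal (f e) (f y)"
    by auto
  define S where "S = {y. \<forall>e\<in>E. orthogonal e y}"
  have S: "subspace S"
    unfolding S_def subspace_def by (auto simp: orthogonal_clauses)
  have "dim E < DIM('a)"
    using dim_le_card'[OF E(1)] E(2) Suc.prems by simp
  then obtain x where x: "x \<noteq> 0" "\<And>y. y \<in> span E \<Longrightarrow> orthogonal x y"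
    by (rule orthogonal_to_subspace_exists) auto
  define K where "K = S \<inter> sphere 0 1"
  have "x /\<^sub>R norm x \<in> K"
    using x by (auto simp: K_def S_def orthogonal_clauses span_base orthogonal_commute)
  moreover have "compact K"
    unfolding K_def by (intro closed_Int_compact closed_subspace S) auto
  moreover have "continuous_on K (\<lambda>y. norm (f y))"
    using f by (intro continuous_on_norm linear_continuous_on linear_conv_bounded_linear[THEN iffD1])
  ultimately obtain e where e: "e \<in> K" and max: "\<And>y. y \<in> K \<Longrightarrow> norm (f y) \<le> norm (f e)"
    using continuous_attains_sup[of K "\<lambda>y. norm (f y)"] by blast
  have e1: "norm e = 1" "e \<in> S" using e by (auto simp: K_def)
  have e_notin: "e \<notin> E" using e1 by (auto simp: S_def orthogonal_def)
  have le: "norm (f v) \<le> norm (f e) * norm v" if "v \<in> S" for v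
  proof (cases "v = 0")
    case False
    then have "v /\<^sub>R norm v \<in> K"
      using that S by (auto simp: K_def subspace_scale)
    from max[OF this] have "norm (f v) / norm v \<le> norm (f e)"
      using f by (simp add: linear_scale divide_inverse mult.commute)
    then show ?thesis using False by (simp add: field_simps)
  qed (use f in \<open>simp add: linear_0\<close>)
  have perp: "orthogonal (f e) (f y)" if y: "y \<in> S" "orthogonal e y" for y
  proof (rule ccontr)
    define p where "p = f e \<bullet> f y"
    \<comment> \<open>\<open>M\<close> exceeds the coefficient of the second-order loss, so the step
      \<open>t = p / M\<close> makes the first-order gain \<open>2 * t * p\<close> win.\<close>
    define M where "M = (norm (f e))\<^sup>2 * (norm y)\<^sup>2 + 1"
    assume "\<not> orthogonal (f e) (f y)"
    then have p: "p \<noteq> 0" by (simp add: p_def orthogonal_def)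
    have M: "0 < M" unfolding M_def by (simp add: add_nonneg_pos)
    define t where "t = p / M"
    have "e + t *\<^sub>R y \<in> S" using S e1 y by (simp add: subspace_add subspace_scale)
    then have "(norm (f (e + t *\<^sub>R y)))\<^sup>2 \<le> (norm (f e) * norm (e + t *\<^sub>R y))\<^sup>2"
      by (intro power_mono le) auto
    also have "\<dots> = (norm (f e))\<^sup>2 * (1 + t\<^sup>2 * (norm y)\<^sup>2)"
    proof -
      have "(norm (e + t *\<^sub>R y))\<^sup>2 = (norm e)\<^sup>2 + (norm (t *\<^sub>R y))\<^sup>2"
        using y by (intro norm_add_Pythagorean) (simp add: orthogonal_clauses)
      then show ?thesis using e1 by (simp add: power_mult_distrib)
    qed
    finally have "(norm (f (e + t *\<^sub>R y)))\<^sup>2 \<le> (norm (f e))\<^sup>2 * (1 + t\<^sup>2 * (norm y)\<^sup>2)" .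
    moreover have "(norm (f (e + t *\<^sub>R y)))\<^sup>2 = (norm (f e))\<^sup>2 + 2 * t * p + t\<^sup>2 * (norm (f y))\<^sup>2"
      using f by (simp add: linear_add linear_scale power2_norm_eq_inner p_def inner_simps
          inner_commute algebra_simps) (simp add: power2_eq_square)
    ultimately have "2 * t * p + t\<^sup>2 * (norm (f y))\<^sup>2 \<le> t\<^sup>2 * ((norm (f e))\<^sup>2 * (norm y)\<^sup>2)"
      by (simp add: algebra_simps)
    moreover have "0 \<le> t\<^sup>2 * (norm (f y))\<^sup>2" by simp
    ultimately have "2 * t * p \<le> t\<^sup>2 * ((norm (f e))\<^sup>2 * (norm y)\<^sup>2)" by linarith
    then have "2 * t * p \<le> t\<^sup>2 * (M - 1)" by (simp add: M_def)
    also have "\<dots> \<le> t\<^sup>2 * M" by (intro mult_left_mono) auto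
    also have "\<dots> = t * p" using M by (simp add: t_def power2_eq_square)
    finally have "t * p \<le> 0" by (simp add: mult.commute)
    moreover have "t * p = p\<^sup>2 / M" by (simp add: t_def power2_eq_square)
    ultimately show False using p M by (simp add: divide_le_0_iff)
  qed
  show ?case
  proof (intro exI[of _ "insert e E"] conjI ballI allI impI)
    show "card (insert e E) = Suc k" using E e_notin by simp
    show "pairwise orthogonal (insert e E)"
      using E e1 by (auto simp: pairwise_insert S_def orthogonal_commute)
    show "pairwise (\<lambda>a b. orthogonal (f a) (f b)) (insert e E)"
      using E(5,6) e1 by (auto simp: pairwise_insert S_def orthogonal_commute)
    fix a y assume "a \<in> insert e E" "\<forall>e'\<in>insert e E. orthogonal e' y"
    then show "orthogonal (f a) (f y)"
      using E(6) perp by (auto simp: S_def)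
  qed (use E e1 in auto)
qed

definition diag_matrix :: "('n \<Rightarrow> real) \<Rightarrow> real^'n^'n" where
  "diag_matrix \<sigma> = (\<chi> i j. if i = j then \<sigma> i else 0)"

lemma diag_matrix_mult_nth [simp]: "(diag_matrix \<sigma> *v x) $ i = \<sigma> i * x $ i"
  by (simp add: diag_matrix_def matrix_vector_mult_def if_distrib[of "\<lambda>z. z * _"] cong: if_cong)

lemma det_diag_matrix [simp]: "det (diag_matrix \<sigma>) = (\<Prod>i\<in>UNIV. \<sigma> i)"
  unfolding diag_matrix_def by (subst det_diagonal) auto

lemma norm_orthogonal_matrix_mult:
  fixes Q :: "real^'n^'n"
  shows "orthogonal_matrix Q \<Longrightarrow> norm (Q *v x) = norm x"
  by (metis matrix_of_matrix_vector_mul matrix_vector_mul_linear orthogonal_transformation_matrix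
      orthogonal_transformation_norm)

text \<open>\<open>orthonormal_set_orthogonal_image\<close> at full dimension supplies the rows of
  \<open>Q\<close>, and \<open>\<sigma>\<close> lists the lengths of their images; Pythagoras does
  the rest. The left orthogonal factor of a singular value decomposition is dropped, since only
  norms matter.\<close>

lemma exists_singular_values:
  fixes A :: "real^'n^'n"
  obtains Q \<sigma> where "orthogonal_matrix Q" "\<And>i. 0 \<le> \<sigma> i"
    "\<And>x. norm (A *v x) = norm (diag_matrix \<sigma> *v (Q *v x))"
proof -
  obtain E where E: "finite E" "card E = CARD('n)" "\<forall>e\<in>E. norm e = 1" "pairwise orthogonal E"
    "pairwise (\<lambda>a b. orthogonal (A *v a) (A *v b)) E"
    using orthonormal_set_orthogonal_image[of "(*v) A" "CARD('n)"] by auto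
  obtain e where e: "bij_betw e (UNIV :: 'n set) E"
    using E finite_same_card_bij[of "UNIV :: 'n set" E] by auto
  then have eE: "e i \<in> E" for i by (auto simp: bij_betw_def)
  have ee: "e i = e j \<longleftrightarrow> i = j" for i j using e by (auto simp: bij_betw_def inj_on_def)
  define Q where "Q = (\<chi> i. e i)"
  define \<sigma> where "\<sigma> i = norm (A *v e i)" for i
  have Q: "orthogonal_matrix Q"
    unfolding orthogonal_matrix_orthonormal_rows
    using E(3,4) eE ee by (auto simp: Q_def row_def pairwise_def)
  have "norm (A *v x) = norm (diag_matrix \<sigma> *v (Q *v x))" for x
  proof -
    have "x = transpose Q *v (Q *v x)"
      using Q by (simp add: matrix_vector_mul_assoc orthogonal_matrix)
    also have "\<dots> = (\<Sum>i\<in>UNIV. (Q *v x) $ i *\<^sub>R e i)"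
      by (simp add: vec_eq_iff matrix_vector_mult_def transpose_def Q_def mult.commute)
    finally have "A *v x = (\<Sum>i\<in>UNIV. (Q *v x) $ i *\<^sub>R (A *v e i))"
      by (metis (mono_tags, lifting) linear_sum matrix_vector_mul_linear matrix_vector_mult_scaleR sum.cong)
    then have "(norm (A *v x))\<^sup>2 = (\<Sum>i\<in>UNIV. (norm ((Q *v x) $ i *\<^sub>R (A *v e i)))\<^sup>2)"
      using E(5) eE ee
      by (simp only:) (rule norm_sum_Pythagorean, auto simp: pairwise_def orthogonal_clauses)
    also have "\<dots> = (norm (diag_matrix \<sigma> *v (Q *v x)))\<^sup>2"
      by (simp add: norm_vec_def L2_set_def sum_nonneg \<sigma>_def power_mult_distrib sum_distrib_left
          mult.commute)
    finally show ?thesis by simp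
  qed
  with that Q show ?thesis by (metis \<sigma>_def norm_ge_zero)
qed

text \<open>Polarization shows that \<open>A\<close> and \<open>B\<close> have the same Gram matrix
  \<open>transpose A ** A\<close>, whose determinant is the square of \<open>det A\<close>.\<close>

lemma abs_det_eq_if_norm_eq:
  fixes A B :: "real^'n^'n"
  assumes "\<And>x. norm (A *v x) = norm (B *v x)"
  shows "\<bar>det A\<bar> = \<bar>det B\<bar>"
proof -
  have pol: "(M *v x) \<bullet> (M *v y) = ((norm (M *v (x + y)))\<^sup>2 - (norm (M *v (x - y)))\<^sup>2) / 4"
    for M :: "real^'n^'n" and x y
    by (simp add: power2_norm_eq_inner matrix_vector_right_distrib matrix_vector_mult_diff_distrib
        algebra_simps inner_commute)
  have "x \<bullet> ((transpose A ** A) *v y) = x \<bullet> ((transpose B ** B) *v y)" for x y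
  proof -
    have "x \<bullet> ((transpose M ** M) *v y) = (M *v x) \<bullet> (M *v y)" for M :: "real^'n^'n"
      by (simp add: dot_lmul_matrix flip: matrix_vector_mul_assoc)
        (metis dot_lmul_matrix inner_commute transpose_matrix_vector transpose_transpose)
    from this[of A] this[of B] show ?thesis by (simp only: pol assms)
  qed
  then have "(transpose A ** A) *v y = (transpose B ** B) *v y" for y
    using vector_eq_ldot by blast
  then have "transpose A ** A = transpose B ** B"
    unfolding matrix_eq by blast
  then have "det A * det A = det B * det B"
    by (metis det_mul det_transpose)
  then show ?thesis by (simp add: abs_eq_iff square_eq_iff)
qed

text \<open>Singular values of \<open>B ** A'\<close>, with \<open>A'\<close> the inverse of
  \<open>A\<close>, give \<open>Q\<close> and \<open>\<sigma>\<close>; then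
  \<open>R = Q ** A\<close> serves both norms.\<close>

lemma simultaneous_diagonalization:
  fixes A B :: "real^'n^'n"
  assumes A: "invertible A" and B: "invertible B"
  obtains R :: "real^'n^'n" and \<sigma> where "invertible R" "\<And>i. 0 < \<sigma> i"
    "\<And>x. norm (A *v x) = norm (R *v x)"
    "\<And>x. norm (B *v x) = norm (diag_matrix \<sigma> *v (R *v x))"
proof -
  obtain A' where A': "A' ** A = mat 1"
    using A by (auto simp: invertible_def)
  obtain Q \<sigma> where Q: "orthogonal_matrix Q" and \<sigma>: "\<And>i. 0 \<le> \<sigma> i" and
    eq: "\<And>x. norm ((B ** A') *v x) = norm (diag_matrix \<sigma> *v (Q *v x))"
    using exists_singular_values by blast
  have inv: "invertible (Q ** A)"
    using Q A by (intro invertible_mult) (auto simp: invertible_def orthogonal_matrix_def)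
  have n1: "norm (A *v x) = norm ((Q ** A) *v x)" for x
    using norm_orthogonal_matrix_mult[OF Q] by (simp flip: matrix_vector_mul_assoc)
  have n2: "norm (B *v x) = norm (diag_matrix \<sigma> *v ((Q ** A) *v x))" for x
    using eq[of "A *v x"] A'
    by (simp add: matrix_vector_mul_assoc) (simp flip: matrix_mul_assoc)
  \<comment> \<open>So far the singular values are only nonnegative; \<open>det B \<noteq> 0\<close>
    excludes zeros.\<close>
  have "\<bar>det B\<bar> = \<bar>det (diag_matrix \<sigma> ** (Q ** A))\<bar>"
    using n2 by (intro abs_det_eq_if_norm_eq) (simp add: matrix_vector_mul_assoc)
  then have "(\<Prod>i\<in>UNIV. \<sigma> i) \<noteq> 0"
    using B by (auto simp: det_mul invertible_det_nz simp del: prod_zero_iff)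
  then have pos: "0 < \<sigma> i" for i using \<sigma>[of i] by (auto simp: order.strict_iff_order)
  show ?thesis by (rule that[of "Q ** A" \<sigma>]) (rule inv pos n1 n2)+
qed

subsection \<open>Linear substitution in Lebesgue integrals\<close>

lemma nn_integral_lborel_translate:
  fixes f :: "'a::euclidean_space \<Rightarrow> ennreal"
  assumes [measurable]: "f \<in> borel_measurable borel"
  shows "(\<integral>\<^sup>+x. f (c + x) \<partial>lborel) = (\<integral>\<^sup>+x. f x \<partial>lborel)"
proof -
  have "(\<integral>\<^sup>+x. f x \<partial>lborel) = (\<integral>\<^sup>+x. f x \<partial>distr lborel borel ((+) c))"
    by (simp add: lborel_distr_plus)
  then show ?thesis by (simp add: nn_integral_distr)
qed

lemma nn_integral_lborel_reflect:
  fixes f :: "'a::euclidean_space \<Rightarrow> ennreal"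
  assumes [measurable]: "f \<in> borel_measurable borel"
  shows "(\<integral>\<^sup>+x. f (c - x) \<partial>lborel) = (\<integral>\<^sup>+x. f x \<partial>lborel)"
  by (subst lborel_affine[of "-1" c]) (simp_all add: nn_integral_density nn_integral_distr)

lemma borel_measurable_matrix_mult [measurable]:
  fixes A :: "real^'n^'m"
  shows "(*v) A \<in> borel_measurable borel"
  by (intro borel_measurable_continuous_onI continuous_intros)

text \<open>Both sides equal the double integral of \<open>g y * f (A x + y)\<close>: the pushforward of Lebesgue
  measure under an invertible linear map is translation invariant, hence a multiple of Lebesgue
  measure. The library's change of variables requires a well-ordered index type.\<close>

lemma nn_integral_matrix_proportional:
  fixes A :: "real^'n^'n" and f g :: "real^'n \<Rightarrow> ennreal"
  assumes A: "invertible A"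
    and [measurable]: "f \<in> borel_measurable borel" "g \<in> borel_measurable borel"
  shows "(\<integral>\<^sup>+y. g y \<partial>lborel) * (\<integral>\<^sup>+x. f (A *v x) \<partial>lborel)
    = (\<integral>\<^sup>+x. g (A *v x) \<partial>lborel) * (\<integral>\<^sup>+y. f y \<partial>lborel)"
proof -
  obtain A' where A': "A ** A' = mat 1"
    using A by (auto simp: invertible_def)
  have inv: "A *v (A' *v y) = y" for y
    by (simp add: matrix_vector_mul_assoc A')
  have "(\<integral>\<^sup>+y. g y \<partial>lborel) * (\<integral>\<^sup>+x. f (A *v x) \<partial>lborel)
      = (\<integral>\<^sup>+y. g y * (\<integral>\<^sup>+x. f (A *v x) \<partial>lborel) \<partial>lborel)"
    by (subst nn_integral_multc) auto
  also have "\<dots> = (\<integral>\<^sup>+y. \<integral>\<^sup>+x. g y * f (A *v x + y) \<partial>lborel \<partial>lborel)"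
  proof (intro nn_integral_cong)
    fix y
    have "(\<integral>\<^sup>+x. f (A *v x) \<partial>lborel) = (\<integral>\<^sup>+x. f (A *v (A' *v y + x)) \<partial>lborel)"
      by (rule nn_integral_lborel_translate[symmetric, where f = "\<lambda>x. f (A *v x)"]) measurable
    also have "\<dots> = (\<integral>\<^sup>+x. f (A *v x + y) \<partial>lborel)"
      by (simp add: matrix_vector_right_distrib inv add.commute)
    finally show "g y * (\<integral>\<^sup>+x. f (A *v x) \<partial>lborel) = (\<integral>\<^sup>+x. g y * f (A *v x + y) \<partial>lborel)"
      by (simp add: nn_integral_cmult)
  qed
  also have "\<dots> = (\<integral>\<^sup>+x. \<integral>\<^sup>+y. g y * f (A *v x + y) \<partial>lborel \<partial>lborel)"
    by (rule lborel_pair.Fubini') measurable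
  also have "\<dots> = (\<integral>\<^sup>+x. \<integral>\<^sup>+y. g (y - A *v x) * f y \<partial>lborel \<partial>lborel)"
  proof (rule nn_integral_cong)
    fix x
    show "(\<integral>\<^sup>+y. g y * f (A *v x + y) \<partial>lborel) = (\<integral>\<^sup>+y. g (y - A *v x) * f y \<partial>lborel)"
      using nn_integral_lborel_translate[of "\<lambda>y. g y * f (A *v x + y)" "- (A *v x)"] by simp
  qed
  also have "\<dots> = (\<integral>\<^sup>+y. \<integral>\<^sup>+x. g (y - A *v x) * f y \<partial>lborel \<partial>lborel)"
    by (rule lborel_pair.Fubini') measurable
  also have "\<dots> = (\<integral>\<^sup>+y. (\<integral>\<^sup>+x. g (A *v x) \<partial>lborel) * f y \<partial>lborel)"
  proof (intro nn_integral_cong)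
    fix y
    have "(\<integral>\<^sup>+x. g (A *v x) \<partial>lborel) = (\<integral>\<^sup>+x. g (A *v (A' *v y - x)) \<partial>lborel)"
      by (rule nn_integral_lborel_reflect[symmetric, where f = "\<lambda>x. g (A *v x)"]) measurable
    also have "\<dots> = (\<integral>\<^sup>+x. g (y - A *v x) \<partial>lborel)"
      by (simp add: matrix_vector_mult_diff_distrib inv)
    finally show "(\<integral>\<^sup>+x. g (y - A *v x) * f y \<partial>lborel) = (\<integral>\<^sup>+x. g (A *v x) \<partial>lborel) * f y"
      by (simp add: nn_integral_multc)
  qed
  also have "\<dots> = (\<integral>\<^sup>+x. g (A *v x) \<partial>lborel) * (\<integral>\<^sup>+y. f y \<partial>lborel)"
    by (rule nn_integral_cmult) measurable
  finally show ?thesis .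
qed

lemma nn_integral_diag_matrix:
  fixes f :: "real^'n \<Rightarrow> ennreal"
  assumes \<sigma>: "\<And>i. 0 < \<sigma> i" and [measurable]: "f \<in> borel_measurable borel"
  shows "ennreal (\<Prod>i\<in>UNIV. \<sigma> i) * (\<integral>\<^sup>+x. f (diag_matrix \<sigma> *v x) \<partial>lborel) = (\<integral>\<^sup>+x. f x \<partial>lborel)"
proof -
  \<comment> \<open>\<open>lborel_affine_euclidean\<close> takes scaling factors indexed by basis
    vectors; the definite description recovers the coordinate.\<close>
  define c where "c b = \<sigma> (THE i. b = axis i 1)" for b :: "real^'n"
  have c: "c (axis i 1) = \<sigma> i" for i by (simp add: c_def axis_eq_axis)
  have B: "(Basis :: (real^'n) set) = (\<lambda>i. axis i 1) ` UNIV" by (auto simp: Basis_vec_def)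
  have inj: "inj (\<lambda>i::'n. axis i (1::real))" by (auto simp: inj_on_def axis_eq_axis)
  have T: "0 + (\<Sum>j\<in>Basis. (c j * (x \<bullet> j)) *\<^sub>R j) = diag_matrix \<sigma> *v x" for x :: "real^'n"
    unfolding B by (subst sum.reindex[OF inj]) 
      (simp add: c inner_axis, simp add: vec_eq_iff axis_def if_distrib[of "\<lambda>z. _ * z"] cong: if_cong)
  have P: "(\<Prod>j\<in>(Basis :: (real^'n) set). \<bar>c j\<bar>) = (\<Prod>i\<in>UNIV. \<sigma> i)"
    unfolding B by (subst prod.reindex[OF inj]) (simp add: c \<sigma> less_imp_le)
  have "lborel = density (distr lborel borel ((*v) (diag_matrix \<sigma>)))
      (\<lambda>_. ennreal (\<Prod>i\<in>UNIV. \<sigma> i))"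
  proof -
    have "c j \<noteq> 0" if "j \<in> Basis" for j
      using that \<sigma> by (auto simp: B c) (metis less_irrefl)
    from lborel_affine_euclidean[of c "0 :: real^'n", OF this] show ?thesis
      unfolding T P .
  qed
  then have "(\<integral>\<^sup>+x. f x \<partial>lborel) = (\<integral>\<^sup>+x. f x \<partial>density (distr lborel borel ((*v) (diag_matrix \<sigma>)))
      (\<lambda>_. ennreal (\<Prod>i\<in>UNIV. \<sigma> i)))" by simp
  also have "\<dots> = ennreal (\<Prod>i\<in>UNIV. \<sigma> i) * (\<integral>\<^sup>+x. f (diag_matrix \<sigma> *v x) \<partial>lborel)"
    by (simp add: nn_integral_density nn_integral_distr nn_integral_cmult)
  finally show ?thesis by simp
qed

text \<open>The ratio in \<open>nn_integral_matrix_proportional\<close> does not depend on the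
  integrand, so one test function determines it: the indicator of the unit ball, which sees only
  norms and thus lets \<open>A\<close> be replaced by
  \<open>diag_matrix \<sigma> ** Q\<close>.\<close>

lemma nn_integral_matrix:
  fixes A :: "real^'n^'n" and f :: "real^'n \<Rightarrow> ennreal"
  assumes A: "invertible A" and [measurable]: "f \<in> borel_measurable borel"
  shows "ennreal \<bar>det A\<bar> * (\<integral>\<^sup>+x. f (A *v x) \<partial>lborel) = (\<integral>\<^sup>+x. f x \<partial>lborel)"
proof -
  obtain Q \<sigma> where Q: "orthogonal_matrix Q" and \<sigma>0: "\<And>i. 0 \<le> \<sigma> i" and
    eq: "\<And>x. norm (A *v x) = norm (diag_matrix \<sigma> *v (Q *v x))"
    using exists_singular_values by blast
  have Qi: "invertible Q" using Q by (auto simp: invertible_def orthogonal_matrix_def)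
  have det: "\<bar>det A\<bar> = (\<Prod>i\<in>UNIV. \<sigma> i)"
  proof -
    have "\<bar>det A\<bar> = \<bar>det (diag_matrix \<sigma> ** Q)\<bar>"
      by (intro abs_det_eq_if_norm_eq) (simp add: eq matrix_vector_mul_assoc)
    also have "\<dots> = (\<Prod>i\<in>UNIV. \<sigma> i)"
      using det_orthogonal_matrix[OF Q] \<sigma>0 by (auto simp: det_mul prod_nonneg)
    finally show ?thesis .
  qed
  then have "(\<Prod>i\<in>UNIV. \<sigma> i) \<noteq> 0" using A by (simp add: invertible_det_nz del: prod_zero_iff)
  then have \<sigma>: "0 < \<sigma> i" for i using \<sigma>0[of i] by (auto simp: order.strict_iff_order)
  define g where "g x = (indicator (cball 0 1) x :: ennreal)" for x :: "real^'n"
  have [measurable]: "g \<in> borel_measurable borel" unfolding g_def by (intro borel_measurable_indicator) simp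
  have radial: "norm x = norm y \<Longrightarrow> g x = g y" for x y by (simp add: g_def indicator_def)
  have g: "(\<integral>\<^sup>+x. g x \<partial>lborel) \<noteq> 0" "(\<integral>\<^sup>+x. g x \<partial>lborel) \<noteq> \<infinity>"
    unfolding g_def
    using less_imp_neq[OF unit_ball_vol_pos[of "CARD('n)"]] by (auto simp: emeasure_cball)
  \<comment> \<open>As \<open>g\<close> is invariant under \<open>Q\<close>, the ratio for
    \<open>Q\<close> is 1, and \<open>Q\<close> disappears from the integral.\<close>
  have "(\<integral>\<^sup>+x. g x \<partial>lborel) * (\<integral>\<^sup>+x. g (diag_matrix \<sigma> *v (Q *v x)) \<partial>lborel)
      = (\<integral>\<^sup>+x. g (Q *v x) \<partial>lborel) * (\<integral>\<^sup>+x. g (diag_matrix \<sigma> *v x) \<partial>lborel)"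
    by (rule nn_integral_matrix_proportional[OF Qi]) measurable
  also have "(\<integral>\<^sup>+x. g (Q *v x) \<partial>lborel) = (\<integral>\<^sup>+x. g x \<partial>lborel)"
    by (intro nn_integral_cong radial norm_orthogonal_matrix_mult Q)
  finally have "(\<integral>\<^sup>+x. g (diag_matrix \<sigma> *v (Q *v x)) \<partial>lborel) = (\<integral>\<^sup>+x. g (diag_matrix \<sigma> *v x) \<partial>lborel)"
    using g by (auto simp: ennreal_mult_cancel_left)
  moreover have "(\<integral>\<^sup>+x. g (A *v x) \<partial>lborel) = (\<integral>\<^sup>+x. g (diag_matrix \<sigma> *v (Q *v x)) \<partial>lborel)"
    by (intro nn_integral_cong radial eq)
  ultimately have gA: "ennreal \<bar>det A\<bar> * (\<integral>\<^sup>+x. g (A *v x) \<partial>lborel) = (\<integral>\<^sup>+x. g x \<partial>lborel)"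
    using nn_integral_diag_matrix[OF \<sigma>, of g] by (simp add: det)
  have "(\<integral>\<^sup>+x. g x \<partial>lborel) * (ennreal \<bar>det A\<bar> * (\<integral>\<^sup>+x. f (A *v x) \<partial>lborel))
      = ennreal \<bar>det A\<bar> * ((\<integral>\<^sup>+x. g (A *v x) \<partial>lborel) * (\<integral>\<^sup>+x. f x \<partial>lborel))"
    by (subst nn_integral_matrix_proportional[OF A, symmetric]) (auto simp: mult_ac)
  also have "\<dots> = (\<integral>\<^sup>+x. g x \<partial>lborel) * (\<integral>\<^sup>+x. f x \<partial>lborel)"
    by (simp add: gA flip: mult.assoc)
  finally show ?thesis
    using g by (auto simp: ennreal_mult_cancel_left)
qed

lemma has_bochner_integral_affine:
  fixes A :: "real^'n^'n" and f :: "real^'n \<Rightarrow> real"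
  assumes A: "invertible A" and f: "integrable lborel f" and nonneg: "\<And>x. 0 \<le> f x"
    and [measurable]: "f \<in> borel_measurable borel"
  shows "has_bochner_integral lborel (\<lambda>x. f (A *v x + b)) ((\<integral>x. f x \<partial>lborel) / \<bar>det A\<bar>)"
proof (rule has_bochner_integral_nn_integral)
  have d: "0 < \<bar>det A\<bar>" using A by (simp add: invertible_det_nz)
  have I: "0 \<le> (\<integral>x. f x \<partial>lborel)" using nonneg by simp
  then show "0 \<le> (\<integral>x. f x \<partial>lborel) / \<bar>det A\<bar>" by simp
  have "ennreal \<bar>det A\<bar> * (\<integral>\<^sup>+x. ennreal (f (A *v x + b)) \<partial>lborel) = (\<integral>\<^sup>+x. ennreal (f (b + x)) \<partial>lborel)"
    by (subst nn_integral_matrix[OF A, symmetric]) (auto simp: add.commute)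
  also have "\<dots> = (\<integral>\<^sup>+x. ennreal (f x) \<partial>lborel)"
    by (rule nn_integral_lborel_translate[where f = "\<lambda>x. ennreal (f x)"]) measurable
  also have "\<dots> = ennreal (\<integral>x. f x \<partial>lborel)"
    using f nonneg by (intro nn_integral_eq_integral) auto
  also have "\<dots> = ennreal \<bar>det A\<bar> * ennreal ((\<integral>x. f x \<partial>lborel) / \<bar>det A\<bar>)"
    using d by (simp flip: ennreal_mult')
  finally show "(\<integral>\<^sup>+x. ennreal (f (A *v x + b)) \<partial>lborel) = ennreal ((\<integral>x. f x \<partial>lborel) / \<bar>det A\<bar>)"
    using d by (auto simp: ennreal_mult_cancel_left)
qed (use nonneg in auto)

section \<open>Integrability of exponentially decaying functions\<close>

lemma nn_integral_exp_abs_finite: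
  assumes "0 < k"
  shows "(\<integral>\<^sup>+t. ennreal (exp (- k * \<bar>t\<bar>)) \<partial>lborel) < \<infinity>"
proof -
  have half: "(\<integral>\<^sup>+t. indicator {0..} t * ennreal (exp (- k * t)) \<partial>lborel) < \<infinity>" (is "?H < _")
  proof -
    have "((\<lambda>t. if t \<in> {0..} then exp (- k * t) else 0) has_integral exp (- k * 0) / k) UNIV"
      unfolding has_integral_restrict_UNIV by (rule has_integral_exp_minus_to_infinity[OF assms])
    then have "(\<integral>\<^sup>+t. ennreal (if t \<in> {0..} then exp (- k * t) else 0) \<partial>lborel) = ennreal (exp (- k * 0) / k)"
      by (intro nn_integral_has_integral_lborel) auto
    moreover have "?H = (\<integral>\<^sup>+t. ennreal (if t \<in> {0..} then exp (- k * t) else 0) \<partial>lborel)"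
      by (intro nn_integral_cong) (auto simp: indicator_def)
    ultimately show ?thesis by simp
  qed
  \<comment> \<open>Only an inequality, because both indicators equal 1 at
    \<open>t = 0\<close>.\<close>
  have "(\<integral>\<^sup>+t. ennreal (exp (- k * \<bar>t\<bar>)) \<partial>lborel)
      \<le> (\<integral>\<^sup>+t. indicator {0..} t * ennreal (exp (- k * t)) + indicator {0..} (-t) * ennreal (exp (- k * -t)) \<partial>lborel)"
    by (intro nn_integral_mono) (auto simp: indicator_def)
  also have "\<dots> = ?H + (\<integral>\<^sup>+t. indicator {0..} (-t) * ennreal (exp (- k * -t)) \<partial>lborel)"
    by (intro nn_integral_add) auto
  also have "(\<integral>\<^sup>+t. indicator {0..} (-t) * ennreal (exp (- k * -t)) \<partial>lborel) = ?H"
    using nn_integral_lborel_reflect[of "\<lambda>t. indicator {0..} t * ennreal (exp (- k * t))" 0] by simp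
  also have "?H + ?H < \<infinity>" using half by (simp add: less_top)
  finally show ?thesis .
qed

text \<open>Every coordinate is bounded by the norm, so splitting \<open>c\<close> evenly over the
  coordinates dominates the integrand by a product of one-dimensional exponentials.\<close>

lemma integrable_exp_norm:
  assumes c: "0 < c"
  shows "integrable lborel (\<lambda>x::'a::euclidean_space. exp (- c * norm x))"
proof (rule integrableI_nonneg)
  define k where "k = c / DIM('a)"
  have k: "0 < k" using c by (simp add: k_def)
  have "exp (- c * norm x) \<le> (\<Prod>b\<in>Basis. exp (- k * \<bar>x \<bullet> b\<bar>))" for x :: 'a
  proof -
    have "(\<Sum>b\<in>Basis. k * \<bar>x \<bullet> b\<bar>) \<le> (\<Sum>b\<in>(Basis::'a set). k * norm x)"
      using k by (intro sum_mono mult_left_mono Basis_le_norm) auto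
    also have "\<dots> = c * norm x" by (simp add: k_def)
    finally show ?thesis by (simp add: sum_negf flip: exp_sum)
  qed
  then have "(\<integral>\<^sup>+(x::'a). ennreal (exp (- c * norm x)) \<partial>lborel)
      \<le> (\<integral>\<^sup>+(x::'a). (\<Prod>b\<in>Basis. ennreal (exp (- k * \<bar>x \<bullet> b\<bar>))) \<partial>lborel)"
    by (intro nn_integral_mono) (simp add: prod_ennreal ennreal_leI)
  also have "\<dots> = (\<Prod>b\<in>(Basis::'a set). (\<integral>\<^sup>+t. ennreal (exp (- k * \<bar>t\<bar>)) \<partial>lborel))"
    by (rule nn_integral_lborel_prod) auto
  also have "\<dots> < \<infinity>"
    using nn_integral_exp_abs_finite[OF k]
    by (cases "\<integral>\<^sup>+t. ennreal (exp (- k * \<bar>t\<bar>)) \<partial>lborel" rule: ennreal_cases)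
      (auto simp: ennreal_power)
  finally show "(\<integral>\<^sup>+(x::'a). ennreal (exp (- c * norm x)) \<partial>lborel) < \<infinity>" .
qed auto

subsection \<open>Uniqueness of the minimizer\<close>

text \<open>The free offset \<open>b\<close> replaces \<open>- A a\<close>: the vector inside the
  norm becomes linear in the parameters, so averaging parameters averages these vectors.\<close>

definition ell :: "real \<Rightarrow> real \<Rightarrow> real^'n^'n \<Rightarrow> real^'n \<Rightarrow> real^'n \<Rightarrow> real" where
  "ell s \<alpha> A b x = \<alpha> * exp (- psi s (norm (A *v x + b)))"

definition psi_mass :: "'n::finite itself \<Rightarrow> real \<Rightarrow> real" where
  "psi_mass _ s = (\<integral>(x::real^'n). exp (- psi s (norm x)) \<partial>lborel)"

definition feasible :: "real \<Rightarrow> (real^'n \<Rightarrow> real) \<Rightarrow> real \<Rightarrow> real^'n^'n \<Rightarrow> real^'n \<Rightarrow> bool" where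
  "feasible s f \<alpha> A b \<longleftrightarrow> 0 < \<alpha> \<and> invertible A \<and> (\<forall>x. f x \<le> ell s \<alpha> A b x)"

text \<open>The integral of a candidate is \<open>\<alpha> / \<bar>det A\<bar>\<close> times a constant depending only on \<open>s\<close> and the
  dimension. Comparing candidates for different \<open>s\<close> through \<open>\<alpha> / \<bar>det A\<bar>\<close> alone avoids that constant.\<close>

definition optimal :: "real \<Rightarrow> (real^'n \<Rightarrow> real) \<Rightarrow> real \<Rightarrow> real^'n^'n \<Rightarrow> real^'n \<Rightarrow> bool" where
  "optimal s f \<alpha> A b \<longleftrightarrow> feasible s f \<alpha> A b \<and>
    (\<forall>\<alpha>' A' b'. feasible s f \<alpha>' A' b' \<longrightarrow> \<alpha> / \<bar>det A\<bar> \<le> \<alpha>' / \<bar>det A'\<bar>)"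

lemma matrix_solve:
  fixes A :: "real^'n^'n"
  assumes "invertible A"
  obtains c where "A *v c = b"
proof -
  obtain A' where "A ** A' = mat 1" using assms by (auto simp: invertible_def)
  then have "A *v (A' *v b) = b" by (simp add: matrix_vector_mul_assoc)
  with that show ?thesis .
qed

lemma E_class_eq:
  "E_class (psi s) = {ell s \<alpha> A b | \<alpha> (A :: real^'n^'n) b. invertible A \<and> 0 < \<alpha>}"
proof (intro equalityI subsetI)
  fix l :: "real^'n \<Rightarrow> real" assume "l \<in> E_class (psi s)"
  then obtain A :: "real^'n^'n" and \<alpha> a where A: "invertible A" "0 < \<alpha>"
    and l: "l = (\<lambda>x. \<alpha> * exp (- psi s (norm (A *v (x - a)))))"
    by (auto simp: E_class_def)
  have "l = ell s \<alpha> A (- (A *v a))"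
    by (simp add: l ell_def fun_eq_iff matrix_vector_mult_diff_distrib)
  then show "l \<in> {ell s \<alpha> A b | \<alpha> (A :: real^'n^'n) b. invertible A \<and> 0 < \<alpha>}"
    using A by blast
next
  fix l assume "l \<in> {ell s \<alpha> A b | \<alpha> (A :: real^'n^'n) b. invertible A \<and> 0 < \<alpha>}"
  then obtain A :: "real^'n^'n" and \<alpha> b where A: "invertible A" "0 < \<alpha>" and l: "l = ell s \<alpha> A b"
    by blast
  obtain c where "A *v c = b" using matrix_solve[OF A(1)] .
  then have "l = (\<lambda>x. \<alpha> * exp (- psi s (norm (A *v (x - (- c))))))"
    by (simp add: l ell_def fun_eq_iff matrix_vector_right_distrib)
  then show "l \<in> E_class (psi s)" unfolding E_class_def using A by blast
qed

text \<open>The case \<open>\<delta> = 1/2\<close> of \<open>psi_ge\<close>: an integrable bound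
  that is uniform for bounded \<open>s\<close>.\<close>

lemma exp_minus_psi_le:
  assumes "0 \<le> s" "0 \<le> t"
  shows "exp (- psi s t) \<le> exp (s * (1 + ln 2)) * exp (- (1 / 2) * t)"
  using psi_ge[of s t "1/2"] assms by (simp add: ln_div flip: exp_add)

lemma borel_measurable_psi_norm:
  "0 \<le> s \<Longrightarrow> (\<lambda>x::real^'n. exp (- psi s (norm x))) \<in> borel_measurable borel"
  by (intro borel_measurable_continuous_onI continuous_intros continuous_on_psi_norm)

lemma integrable_psi_norm:
  assumes "0 \<le> s"
  shows "integrable lborel (\<lambda>x::real^'n. exp (- psi s (norm x)))"
proof (rule Bochner_Integration.integrable_bound)
  show "integrable lborel (\<lambda>x::real^'n. exp (s * (1 + ln 2)) * exp (- (1 / 2) * norm x))"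
    by (intro integrable_mult_right integrable_exp_norm) simp
qed (use borel_measurable_psi_norm[OF assms] exp_minus_psi_le[OF assms] in auto)

lemma psi_mass_pos:
  assumes "0 \<le> s"
  shows "0 < psi_mass TYPE('n::finite) s"
proof -
  have "(\<integral>(x::real^'n). exp (- psi s (norm x)) \<partial>lborel) \<noteq> 0"
    by (subst integral_nonneg_eq_0_iff_AE[OF integrable_psi_norm[OF assms]])
      (auto simp: ae_filter_eq_bot_iff)
  moreover have "0 \<le> (\<integral>(x::real^'n). exp (- psi s (norm x)) \<partial>lborel)" by simp
  ultimately show ?thesis by (metis psi_mass_def order_le_less)
qed

lemma integral_ell:
  fixes A :: "real^'n^'n"
  assumes "0 \<le> s" "invertible A"
  shows "(\<integral>x. ell s \<alpha> A b x \<partial>lborel) = \<alpha> / \<bar>det A\<bar> * psi_mass TYPE('n) s"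
  using has_bochner_integral_affine[OF assms(2) integrable_psi_norm[OF assms(1)] _
      borel_measurable_psi_norm[OF assms(1)], of b]
  by (simp add: ell_def[abs_def] psi_mass_def has_bochner_integral_iff)

text \<open>By \<open>integral_ell\<close> all competing integrals share the factor
  \<open>psi_mass\<close>, which is positive and cancels.\<close>

lemma is_Loewner_iff:
  fixes f :: "real^'n \<Rightarrow> real"
  assumes s: "0 \<le> s"
  shows "is_Loewner s f l \<longleftrightarrow> (\<exists>\<alpha> A b. optimal s f \<alpha> A b \<and> l = ell s \<alpha> A b)"
proof -
  have *: "l \<in> E_class (psi s) \<and> (\<forall>x. f x \<le> l x) \<longleftrightarrow> (\<exists>\<alpha> A b. feasible s f \<alpha> A b \<and> l = ell s \<alpha> A b)" for l
    unfolding E_class_eq feasible_def by blast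
  then have "is_Loewner s f l \<longleftrightarrow> (\<exists>\<alpha> A b. (feasible s f \<alpha> A b \<and>
      (\<forall>\<alpha>' A' b'. feasible s f \<alpha>' A' b' \<longrightarrow>
        (\<integral>x. ell s \<alpha> A b x \<partial>lborel) \<le> (\<integral>x. ell s \<alpha>' A' b' x \<partial>lborel))) \<and> l = ell s \<alpha> A b)"
    unfolding is_Loewner_def is_arg_min_def * by (simp only: not_less de_Morgan_conj not_ex) blast
  moreover have "(\<integral>x. ell s \<alpha> A b x \<partial>lborel) = \<alpha> / \<bar>det A\<bar> * psi_mass TYPE('n) s"
    if "feasible s f \<alpha> A b" for \<alpha> A b
    using that by (intro integral_ell[OF s]) (simp add: feasible_def)
  ultimately show ?thesis
    unfolding optimal_def using psi_mass_pos[OF s, where 'n='n]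
    by (simp only: mult_le_cancel_right_pos cong: conj_cong imp_cong)
qed

text \<open>The averaged candidate dominates the geometric mean of the two candidates, because \<open>psi s\<close> is
  convex and increasing.\<close>

lemma feasible_average:
  fixes A B :: "real^'n^'n"
  assumes s: "0 \<le> s" and 1: "feasible s f \<alpha> A a" and 2: "feasible s f \<beta> B b"
    and C: "invertible C" "\<And>x. C *v x = (1 / 2) *\<^sub>R (A *v x + B *v x)"
  shows "feasible s f (sqrt (\<alpha> * \<beta>)) C ((1 / 2) *\<^sub>R (a + b))"
proof -
  have pos: "0 < \<alpha>" "0 < \<beta>" using 1 2 by (auto simp: feasible_def)
  have "f x \<le> ell s (sqrt (\<alpha> * \<beta>)) C ((1 / 2) *\<^sub>R (a + b)) x" for x
  proof -
    define p q where "p = norm (A *v x + a)" and "q = norm (B *v x + b)"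
    have "norm (C *v x + (1 / 2) *\<^sub>R (a + b)) \<le> 1 / 2 * p + 1 / 2 * q"
    proof -
      have "C *v x + (1 / 2) *\<^sub>R (a + b) = (1 / 2) *\<^sub>R (A *v x + a) + (1 / 2) *\<^sub>R (B *v x + b)"
        by (simp add: C algebra_simps)
      then show ?thesis unfolding p_def q_def by (metis norm_triangle_ineq norm_scaleR abs_of_nonneg zero_le_divide_1_iff zero_le_numeral)
    qed
    then have "psi s (norm (C *v x + (1 / 2) *\<^sub>R (a + b))) \<le> psi s ((1 - 1 / 2) *\<^sub>R p + (1 / 2) *\<^sub>R q)"
      using s by (intro psi_mono) auto
    also have "\<dots> \<le> (1 - 1 / 2) * psi s p + 1 / 2 * psi s q"
      by (rule convex_onD[OF convex_on_psi[OF s]]) (auto simp: p_def q_def)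
    finally have le: "psi s (norm (C *v x + (1 / 2) *\<^sub>R (a + b))) \<le> (psi s p + psi s q) / 2" by simp
    define u v where "u = \<alpha> * exp (- psi s p)" and "v = \<beta> * exp (- psi s q)"
    have uv: "0 < u" "0 < v" using pos by (auto simp: u_def v_def)
    have "f x \<le> min u v"
      using 1 2 by (auto simp: feasible_def ell_def u_def v_def p_def q_def)
    also have "\<dots> \<le> sqrt (u * v)"
      using uv by (intro real_le_rsqrt) (auto simp: power2_eq_square intro!: mult_mono)
    also have "u * v = (\<alpha> * \<beta>) * (exp (- (psi s p + psi s q) / 2))\<^sup>2"
      by (simp add: u_def v_def exp_double[symmetric] exp_add[symmetric])
    also have "sqrt \<dots> = sqrt (\<alpha> * \<beta>) * exp (- (psi s p + psi s q) / 2)"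
      by (simp add: real_sqrt_mult)
    also have "\<dots> \<le> ell s (sqrt (\<alpha> * \<beta>)) C ((1 / 2) *\<^sub>R (a + b)) x"
      unfolding ell_def using le pos by (intro mult_left_mono) auto
    finally show ?thesis .
  qed
  then show ?thesis using pos C by (auto simp: feasible_def)
qed

text \<open>One strict factor would make the whole product strictly larger. This extracts the
  equality case of the arithmetic-geometric mean inequality coordinate by coordinate.\<close>

lemma prod_less_eq_imp_eq:
  fixes f g :: "'i \<Rightarrow> real"
  assumes "finite I" "\<And>i. i \<in> I \<Longrightarrow> 0 < f i" "\<And>i. i \<in> I \<Longrightarrow> f i \<le> g i" "prod g I \<le> prod f I"
    and "i \<in> I"
  shows "f i = g i"
proof (rule ccontr)
  assume "f i \<noteq> g i"
  then have lt: "f i < g i" using assms(3,5) by (simp add: order.strict_iff_order)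
  have "prod f I = f i * prod f (I - {i})" using assms by (simp add: prod.remove)
  also have "\<dots> < g i * prod f (I - {i})" using lt assms(2) by (intro mult_strict_right_mono prod_pos) auto
  also have "\<dots> \<le> g i * prod g (I - {i})"
  proof -
    have "0 \<le> g i" using lt assms(2)[OF assms(5)] by simp
    then show ?thesis using assms(2,3) by (intro mult_left_mono prod_mono) (auto simp: less_imp_le)
  qed
  also have "\<dots> = prod g I" using assms by (simp add: prod.remove)
  finally show False using assms(4) by simp
qed

text \<open>The gain from intersecting two translates of the same profile: when both \<open>norm (z + h)\<close> and
  \<open>norm (z - h)\<close> are available, their maximum is at least \<open>sqrt ((norm z)\<^sup>2 + (norm h)\<^sup>2)\<close>.
  Shrinking the argument by \<open>exp (- t\<^sup>2)\<close> then costs order \<open>t\<^sup>2\<close> but gains order \<open>t\<close>.\<close>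

lemma psi_sqrt_gain:
  assumes s: "0 \<le> s" and h: "0 < h" and C: "0 \<le> C"
  obtains t \<kappa> where "0 < t" "C * t\<^sup>2 < \<kappa>"
    "\<And>z. 0 \<le> z \<Longrightarrow> psi s (exp (- t\<^sup>2) * z) + \<kappa> \<le> psi s (sqrt (z\<^sup>2 + h\<^sup>2))"
proof -
  \<comment> \<open>Chosen so that \<open>2 * \<delta> + \<delta>\<^sup>2 = h\<^sup>2\<close>, hence
    \<open>z + \<delta> \<le> sqrt (z\<^sup>2 + h\<^sup>2)\<close> for
    \<open>0 \<le> z \<le> 1\<close>.\<close>
  define \<delta> where "\<delta> = sqrt (1 + h\<^sup>2) - 1"
  have \<delta>: "0 < \<delta>" using h by (simp add: \<delta>_def)
  \<comment> \<open>\<open>P\<close> is the gain available for \<open>z \<le> 1\<close>, and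
    \<open>t * K\<close> the gain for \<open>z > 1\<close>.\<close>
  define K P where "K = 2 * h * psi s (1 / 2)" and "P = psi s \<delta>"
  have KP: "0 < K" "0 < P" using psi_pos[OF s] h \<delta> by (auto simp: K_def P_def)
  \<comment> \<open>Small enough that \<open>C * t\<close> lies below both \<open>K\<close> and
    \<open>P\<close>; the bound 1/2 keeps \<open>exp (- t\<^sup>2)\<close> above 1/2.\<close>
  define t where "t = min (1 / 2) (min K P / (2 * (C + 1)))"
  have t: "0 < t" "t \<le> 1 / 2" unfolding t_def using KP C by (simp, linarith)
  have "(C + 1) * t \<le> (C + 1) * (min K P / (2 * (C + 1)))"
    using C by (intro mult_left_mono) (auto simp: t_def)
  also have "(C + 1) * (m / (2 * (C + 1))) = m / 2" for m using C by (simp add: field_simps)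
  finally have Ct: "C * t < K" "C * t < P" using t KP C by (auto simp: algebra_simps)
  define q where "q = exp (- t\<^sup>2)"
  define \<kappa> where "\<kappa> = min P (t * K)"
  have t2: "t\<^sup>2 \<le> 1 / 4" using power_mono[OF t(2), of 2] t(1) by (simp add: power_divide)
  have q: "0 < q" "q \<le> 1" by (auto simp: q_def)
  have q_ge: "1 / 2 \<le> q"
    using exp_ge_add_one_self[of "- t\<^sup>2"] t2 unfolding q_def by linarith
  have qt: "q\<^sup>2 + t\<^sup>2 \<le> 1"
  proof -
    have "1 \<le> (1 - t\<^sup>2) * (1 + 2 * t\<^sup>2)"
    proof -
      have "t\<^sup>2 * (2 * t\<^sup>2) \<le> t\<^sup>2 * 1" using t2 by (intro mult_left_mono) auto
      then show ?thesis by (simp add: algebra_simps)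
    qed
    also have "\<dots> \<le> (1 - t\<^sup>2) * exp (2 * t\<^sup>2)"
      using exp_ge_add_one_self[of "2 * t\<^sup>2"] t2 by (intro mult_left_mono) auto
    finally have "exp (- (2 * t\<^sup>2)) \<le> 1 - t\<^sup>2"
      by (simp add: exp_minus field_simps)
    moreover have "q\<^sup>2 = exp (- (2 * t\<^sup>2))" by (simp add: q_def flip: exp_double)
    ultimately show ?thesis by simp
  qed
  have "C * t\<^sup>2 < \<kappa>"
  proof -
    have "C * t\<^sup>2 = t * (C * t)" by (simp add: power2_eq_square)
    moreover have "t * (C * t) < t * K" using Ct t by simp
    moreover have "t * (C * t) \<le> 1 * (C * t)" using t C by (intro mult_right_mono) auto
    ultimately have "C * t\<^sup>2 < t * K" "C * t\<^sup>2 < P" using Ct by linarith+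
    then show ?thesis by (simp add: \<kappa>_def)
  qed
  moreover have "psi s (q * z) + \<kappa> \<le> psi s (sqrt (z\<^sup>2 + h\<^sup>2))" if z: "0 \<le> z" for z
  proof (cases "z \<le> 1")
    case True
    have "z + \<delta> \<le> sqrt (z\<^sup>2 + h\<^sup>2)"
    proof (rule real_le_rsqrt)
      have "z * \<delta> \<le> \<delta>" using True \<delta> by (simp add: mult_left_le_one_le z)
      then have "(z + \<delta>)\<^sup>2 \<le> z\<^sup>2 + (2 * \<delta> + \<delta>\<^sup>2)" by (simp add: power2_sum)
      also have "2 * \<delta> + \<delta>\<^sup>2 = h\<^sup>2"
        by (simp add: \<delta>_def power2_diff)
      finally show "(z + \<delta>)\<^sup>2 \<le> z\<^sup>2 + h\<^sup>2" .
    qed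
    then have "psi s (z + \<delta>) \<le> psi s (sqrt (z\<^sup>2 + h\<^sup>2))"
      using s z \<delta> by (intro psi_mono) auto
    moreover have "psi s z + P \<le> psi s (z + \<delta>)"
      unfolding P_def using s z \<delta> by (intro psi_superadditive) auto
    moreover have "psi s (q * z) \<le> psi s z"
      using s z q by (intro psi_mono) (auto simp: mult_left_le_one_le)
    ultimately show ?thesis by (simp add: \<kappa>_def)
  next
    case False
    have "q * z + t * h \<le> sqrt (z\<^sup>2 + h\<^sup>2)"
    proof (rule real_le_rsqrt)
      \<comment> \<open>The added square completes Lagrange's identity for \<open>(q, t)\<close> and
        \<open>(z, h)\<close>.\<close>
      have "(q * z + t * h)\<^sup>2 \<le> (q * z + t * h)\<^sup>2 + (q * h - t * z)\<^sup>2" by simp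
      also have "(q * z + t * h)\<^sup>2 + (q * h - t * z)\<^sup>2 = (q\<^sup>2 + t\<^sup>2) * (z\<^sup>2 + h\<^sup>2)"
        by (simp add: power2_eq_square algebra_simps)
      also have "\<dots> \<le> 1 * (z\<^sup>2 + h\<^sup>2)" using qt by (intro mult_right_mono) auto
      finally show "(q * z + t * h)\<^sup>2 \<le> z\<^sup>2 + h\<^sup>2" by simp
    qed
    then have "psi s (q * z + t * h) \<le> psi s (sqrt (z\<^sup>2 + h\<^sup>2))"
      using s z q t h by (intro psi_mono) auto
    moreover have "1 / 2 * 1 \<le> q * z" using False q_ge by (intro mult_mono) auto
    then have "psi s (q * z) + t * h * (psi s (1 / 2) / (1 / 2)) \<le> psi s (q * z + t * h)"
      using s t h by (intro psi_add_ge_slope) auto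
    ultimately show ?thesis by (simp add: \<kappa>_def K_def)
  qed
  ultimately show ?thesis using that[of t \<kappa>] t(1) by (simp add: q_def)
qed

lemma feasible_cong_norm:
  assumes "feasible s f \<alpha> A a" "invertible B" "\<And>x. norm (A *v x + a) = norm (B *v x + b)"
  shows "feasible s f \<alpha> B b"
  using assms by (auto simp: feasible_def ell_def)

text \<open>With \<open>a = A *v c\<close>, the hypothesis at \<open>x + c\<close> yields
  \<open>b = B *v c\<close>.\<close>

lemma norm_matrix_affine_transfer:
  fixes A B :: "real^'n^'n"
  assumes "invertible A" "\<And>x. norm (A *v x) = norm (B *v x)"
  obtains b where "\<And>x. norm (A *v x + a) = norm (B *v x + b)"
proof -
  obtain c where "A *v c = a" using matrix_solve[OF assms(1)] .
  then have "norm (A *v x + a) = norm (B *v x + B *v c)" for x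
    using assms(2)[of "x + c"] by (simp add: matrix_vector_right_distrib)
  with that show ?thesis .
qed

text \<open>With \<open>z\<close> centred at the midpoint of the offsets, \<open>f\<close> lies
  below the profile taken at the larger of \<open>norm (z + h)\<close> and
  \<open>norm (z - h)\<close>. By \<open>psi_sqrt_gain\<close>, shrinking the matrix by
  \<open>q\<close> and the height by \<open>exp (- \<kappa>)\<close> stays feasible, while the value
  changes by the factor \<open>exp (- \<kappa>) / q ^ CARD('n)\<close>, which is below 1.\<close>

lemma optimal_translates_eq:
  fixes R :: "real^'n^'n"
  assumes s: "0 \<le> s" and 1: "optimal s f \<alpha> R a" and 2: "feasible s f \<alpha> R b"
  shows "a = b"
proof (rule ccontr)
  assume "a \<noteq> b"
  define h where "h = (1 / 2) *\<^sub>R (a - b)"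
  have h: "0 < norm h" using \<open>a \<noteq> b\<close> by (simp add: h_def)
  have \<alpha>: "0 < \<alpha>" and R: "invertible R" using 2 by (auto simp: feasible_def)
  \<comment> \<open>The constant is the dimension, because scaling the matrix by
    \<open>exp (- t\<^sup>2)\<close> scales its determinant by that factor to the power
    \<open>CARD('n)\<close>.\<close>
  obtain t \<kappa> :: real where t: "0 < t" "CARD('n) * t\<^sup>2 < \<kappa>" and
    gain: "\<And>z. 0 \<le> z \<Longrightarrow> psi s (exp (- t\<^sup>2) * z) + \<kappa> \<le> psi s (sqrt (z\<^sup>2 + (norm h)\<^sup>2))"
    using psi_sqrt_gain[OF s h, of "CARD('n)"] by auto
  define q where "q = exp (- t\<^sup>2)"
  define r where "r = (1 / 2) *\<^sub>R (a + b)"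
  have qR: "(q *\<^sub>R R) *v x = q *\<^sub>R (R *v x)" for x
    by (rule scaleR_matrix_vector_assoc[symmetric])
  have det: "det (q *\<^sub>R R) = q ^ CARD('n) * det R"
  proof -
    have "q *\<^sub>R R = diag_matrix (\<lambda>_. q) ** R"
      by (simp add: matrix_eq vec_eq_iff qR flip: matrix_vector_mul_assoc)
    then show ?thesis by (simp add: det_mul)
  qed
  have "f x \<le> ell s (\<alpha> * exp (- \<kappa>)) (q *\<^sub>R R) (q *\<^sub>R r) x" for x
  proof -
    define z where "z = R *v x + r"
    have z: "R *v x + a = z + h" "R *v x + b = z - h"
      by (auto simp: z_def h_def r_def vec_eq_iff field_simps)
    have "sqrt ((norm z)\<^sup>2 + (norm h)\<^sup>2) \<le> max (norm (z + h)) (norm (z - h))"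
    proof (rule real_le_lsqrt)
      have "2 * ((norm z)\<^sup>2 + (norm h)\<^sup>2) = (norm (z + h))\<^sup>2 + (norm (z - h))\<^sup>2"
        by (simp add: power2_norm_eq_inner inner_simps inner_commute)
      moreover have "(norm (z + h))\<^sup>2 \<le> (max (norm (z + h)) (norm (z - h)))\<^sup>2"
        "(norm (z - h))\<^sup>2 \<le> (max (norm (z + h)) (norm (z - h)))\<^sup>2"
        by (intro power_mono; simp)+
      moreover have "2 * w = u + v \<Longrightarrow> u \<le> m \<Longrightarrow> v \<le> m \<Longrightarrow> w \<le> m" for u v w m :: real
        by linarith
      ultimately show "(norm z)\<^sup>2 + (norm h)\<^sup>2 \<le> (max (norm (z + h)) (norm (z - h)))\<^sup>2"
        by blast
    qed (simp add: max_def)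
    then have "psi s (sqrt ((norm z)\<^sup>2 + (norm h)\<^sup>2)) \<le> psi s (max (norm (z + h)) (norm (z - h)))"
      using s by (intro psi_mono) auto
    with gain[of "norm z"]
    have le: "psi s (q * norm z) + \<kappa> \<le> psi s (max (norm (z + h)) (norm (z - h)))"
      by (simp add: q_def)
    have "f x \<le> \<alpha> * exp (- psi s (max (norm (z + h)) (norm (z - h))))"
      using 1 2 unfolding optimal_def feasible_def ell_def z[symmetric] by (auto simp: max_def)
    also have "\<dots> \<le> \<alpha> * exp (- (psi s (q * norm z) + \<kappa>))"
      using le \<alpha> by simp
    also have "\<dots> = ell s (\<alpha> * exp (- \<kappa>)) (q *\<^sub>R R) (q *\<^sub>R r) x"
    proof -
      have "norm ((q *\<^sub>R R) *v x + q *\<^sub>R r) = q * norm z"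
        unfolding qR z_def scaleR_add_right[symmetric] by (simp add: q_def)
      then show ?thesis by (simp add: ell_def exp_add[symmetric] algebra_simps)
    qed
    finally show ?thesis .
  qed
  moreover have "invertible (q *\<^sub>R R)"
    using R unfolding invertible_det_nz det by (simp add: q_def)
  ultimately have "feasible s f (\<alpha> * exp (- \<kappa>)) (q *\<^sub>R R) (q *\<^sub>R r)"
    using \<alpha> by (simp add: feasible_def)
  then have "\<alpha> / \<bar>det R\<bar> \<le> \<alpha> * exp (- \<kappa>) / \<bar>det (q *\<^sub>R R)\<bar>"
    using 1 unfolding optimal_def by blast
  then have "\<alpha> / \<bar>det R\<bar> \<le> \<alpha> / \<bar>det R\<bar> * (exp (- \<kappa>) / q ^ CARD('n))"
    unfolding det by (simp add: abs_mult q_def mult_ac)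
  moreover have "0 < \<alpha> / \<bar>det R\<bar>" using \<alpha> R by (simp add: invertible_det_nz)
  ultimately have "1 \<le> exp (- \<kappa>) / q ^ CARD('n)"
    by (metis mult.right_neutral mult_le_cancel_left_pos)
  then have "q ^ CARD('n) \<le> exp (- \<kappa>)" by (simp add: q_def field_simps)
  also have "q ^ CARD('n) = exp (- (CARD('n) * t\<^sup>2))"
    by (simp add: q_def flip: exp_of_nat_mult)
  finally show False using t by simp
qed

text \<open>After simultaneous diagonalization the matrices become \<open>R\<close> and
  \<open>diag_matrix \<sigma> ** R\<close>. Optimality against the averaged candidate says that the
  product of the \<open>(1 + \<sigma> i) / 2\<close> is at most that of the
  \<open>sqrt (\<sigma> i)\<close>, which forces \<open>\<sigma> i = 1\<close>; only a difference of
  offsets remains.\<close>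

lemma optimal_unique:
  fixes A B :: "real^'n^'n"
  assumes s: "0 \<le> s" and 1: "optimal s f \<alpha> A a" and 2: "optimal s f \<beta> B b"
  shows "ell s \<alpha> A a = ell s \<beta> B b"
proof -
  have f1: "feasible s f \<alpha> A a" and f2: "feasible s f \<beta> B b"
    using 1 2 by (auto simp: optimal_def)
  then have inv: "invertible A" "invertible B" and pos: "0 < \<alpha>" "0 < \<beta>"
    by (auto simp: feasible_def)
  obtain R :: "real^'n^'n" and \<sigma> where R: "invertible R" and \<sigma>: "\<And>i. 0 < \<sigma> i"
    and nA: "\<And>x. norm (A *v x) = norm (R *v x)"
    and nB': "\<And>x. norm (B *v x) = norm (diag_matrix \<sigma> *v (R *v x))"
    by (rule simultaneous_diagonalization[OF inv], rule that)
  have nB: "norm (B *v x) = norm ((diag_matrix \<sigma> ** R) *v x)" for x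
    unfolding nB' by (simp add: matrix_vector_mul_assoc)
  obtain a' where a': "\<And>x. norm (A *v x + a) = norm (R *v x + a')"
    by (rule norm_matrix_affine_transfer[OF inv(1) nA, of a], rule that)
  obtain b' where b': "\<And>x. norm (B *v x + b) = norm ((diag_matrix \<sigma> ** R) *v x + b')"
    by (rule norm_matrix_affine_transfer[OF inv(2) nB, of b], rule that)
  have dA: "\<bar>det A\<bar> = \<bar>det R\<bar>" using nA by (rule abs_det_eq_if_norm_eq)
  have \<sigma>_prod: "0 < (\<Prod>i\<in>UNIV. \<sigma> i)" using \<sigma> by (intro prod_pos) auto
  have dB: "\<bar>det B\<bar> = (\<Prod>i\<in>UNIV. \<sigma> i) * \<bar>det R\<bar>"
    using abs_det_eq_if_norm_eq[OF nB] \<sigma>_prod by (simp add: det_mul abs_mult)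
  have dR: "0 < \<bar>det R\<bar>" using R by (simp add: invertible_det_nz)
  have invD: "invertible (diag_matrix \<tau> ** R)" if "\<And>i. 0 < \<tau> i" for \<tau>
    using R that by (simp add: invertible_det_nz det_mul less_imp_neq[symmetric])
  have f1': "feasible s f \<alpha> R a'" using feasible_cong_norm[OF f1 R a'] .
  have f2': "feasible s f \<beta> (diag_matrix \<sigma> ** R) b'" using feasible_cong_norm[OF f2 invD[OF \<sigma>] b'] .
  have "\<alpha> / \<bar>det A\<bar> = \<beta> / \<bar>det B\<bar>"
    using 1 2 unfolding optimal_def by (blast intro: order_antisym)
  \<comment> \<open>Two optimal candidates have the same value, which ties the heights to the
    determinants.\<close>
  then have \<beta>: "\<beta> = \<alpha> * (\<Prod>i\<in>UNIV. \<sigma> i)"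
  proof -
    have "y = x * p" if "x / d = y / (p * d)" "0 < d" "0 < p" for x y p d :: real
      using that by (simp add: field_simps)
    from this[OF _ dR \<sigma>_prod] show ?thesis using \<open>\<alpha> / \<bar>det A\<bar> = \<beta> / \<bar>det B\<bar>\<close> by (simp only: dA dB)
  qed
  define C where "C = diag_matrix (\<lambda>i. (1 + \<sigma> i) / 2) ** R"
  have C: "invertible C" unfolding C_def using \<sigma> by (intro invD) (simp add: add_pos_pos)
  have Cx: "C *v x = (1 / 2) *\<^sub>R (R *v x + (diag_matrix \<sigma> ** R) *v x)" for x
    by (simp add: C_def vec_eq_iff field_simps flip: matrix_vector_mul_assoc)
  have P: "0 < (\<Prod>i\<in>UNIV. (1 + \<sigma> i) / 2)"
    using \<sigma> by (intro prod_pos) (simp add: add_pos_pos)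
  have "\<bar>det C\<bar> = (\<Prod>i\<in>UNIV. (1 + \<sigma> i) / 2) * \<bar>det R\<bar>"
    unfolding C_def det_mul abs_mult det_diag_matrix abs_of_pos[OF P] ..
  moreover have "sqrt (\<alpha> * \<beta>) = \<alpha> * sqrt (\<Prod>i\<in>UNIV. \<sigma> i)"
    using pos by (simp add: \<beta> real_sqrt_mult)
  moreover have "\<alpha> / \<bar>det A\<bar> \<le> sqrt (\<alpha> * \<beta>) / \<bar>det C\<bar>"
    using 1 feasible_average[OF s f1' f2' C Cx] unfolding optimal_def by blast
  ultimately have le: "\<alpha> / \<bar>det R\<bar> \<le> \<alpha> * sqrt (\<Prod>i\<in>UNIV. \<sigma> i) / ((\<Prod>i\<in>UNIV. (1 + \<sigma> i) / 2) * \<bar>det R\<bar>)"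
    by (simp only: dA)
  have "p \<le> y" if "x / d \<le> x * y / (p * d)" "0 < d" "0 < p" "0 < x" for x y p d :: real
    using that by (simp add: field_simps)
  from this[OF le dR P pos(1)] have "(\<Prod>i\<in>UNIV. (1 + \<sigma> i) / 2) \<le> sqrt (\<Prod>i\<in>UNIV. \<sigma> i)" .
  also have "sqrt (\<Prod>i\<in>I. \<sigma> i) = (\<Prod>i\<in>I. sqrt (\<sigma> i))" for I
    by (induction I rule: infinite_finite_induct) (auto simp: real_sqrt_mult)
  finally have le: "(\<Prod>i\<in>UNIV. (1 + \<sigma> i) / 2) \<le> (\<Prod>i\<in>UNIV. sqrt (\<sigma> i))" .
  have \<sigma>1: "\<sigma> i = 1" for i
  proof -
    \<comment> \<open>Termwise the arithmetic-geometric mean inequality, against the reverse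
      inequality \<open>le\<close> between the products.\<close>
    have "sqrt (\<sigma> i) \<le> (1 + \<sigma> i) / 2" for i
      using arith_geo_mean_sqrt[of 1 "\<sigma> i"] \<sigma>[of i] by simp
    with le \<sigma> have "sqrt (\<sigma> i) = (1 + \<sigma> i) / 2"
      by (intro prod_less_eq_imp_eq[of UNIV]) auto
    then have "(sqrt (\<sigma> i) - 1)\<^sup>2 = 0"
      using \<sigma>[of i] by (simp add: power2_diff)
    then show ?thesis by simp
  qed
  then have D: "diag_matrix \<sigma> ** R = R"
    by (simp add: matrix_eq vec_eq_iff flip: matrix_vector_mul_assoc)
  have \<beta>\<alpha>: "\<beta> = \<alpha>" using \<beta> \<sigma>1 by simp
  have "optimal s f \<alpha> R a'" using f1' 1 dA by (simp add: optimal_def)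
  moreover have "feasible s f \<alpha> R b'" using f2' by (simp add: D \<beta>\<alpha>)
  ultimately have "a' = b'" by (rule optimal_translates_eq[OF s])
  then show ?thesis by (simp add: fun_eq_iff ell_def a' b' D \<beta>\<alpha>)
qed

subsection \<open>Bounds for log-concave functions\<close>

text \<open>Where \<open>f\<close> is positive the exponent is finite, so the extended-real
  convexity inequality becomes a real one.\<close>

lemma log_concave_ln:
  assumes f: "log_concave f" and "0 < f x" "0 < f y" "0 \<le> u" "0 \<le> v" "u + v = 1"
  shows "0 < f (u *\<^sub>R x + v *\<^sub>R y)"
    and "u * ln (f x) + v * ln (f y) \<le> ln (f (u *\<^sub>R x + v *\<^sub>R y))"
proof -
  obtain \<phi> where \<phi>: "ereal_convex \<phi>" and f: "\<And>x. f x = exp_minus_ereal (\<phi> x)"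
    using f by (auto simp: log_concave_def)
  have fin: "\<phi> z \<noteq> - \<infinity>" for z using \<phi> by (simp add: ereal_convex_def)
  obtain a where a: "\<phi> x = ereal a"
    using assms(2) fin[of x] by (cases "\<phi> x") (auto simp: f exp_minus_ereal_def)
  obtain b where b: "\<phi> y = ereal b"
    using assms(3) fin[of y] by (cases "\<phi> y") (auto simp: f exp_minus_ereal_def)
  have "\<phi> (u *\<^sub>R x + v *\<^sub>R y) \<le> ereal u * \<phi> x + ereal v * \<phi> y"
    using \<phi> assms unfolding ereal_convex_def by blast
  then obtain c where c: "\<phi> (u *\<^sub>R x + v *\<^sub>R y) = ereal c" "c \<le> u * a + v * b"
    using fin[of "u *\<^sub>R x + v *\<^sub>R y"] by (cases "\<phi> (u *\<^sub>R x + v *\<^sub>R y)") (auto simp: a b)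
  show "0 < f (u *\<^sub>R x + v *\<^sub>R y)" by (simp add: f c exp_minus_ereal_def)
  show "u * ln (f x) + v * ln (f y) \<le> ln (f (u *\<^sub>R x + v *\<^sub>R y))"
    using c by (simp add: f a b exp_minus_ereal_def)
qed

lemma convex_superlevel_log_concave:
  assumes f: "log_concave f" and e: "0 < e"
  shows "convex {x. e \<le> f x}"
proof (rule convexI)
  fix x y and u v :: real
  assume xy: "x \<in> {x. e \<le> f x}" "y \<in> {x. e \<le> f x}" and uv: "0 \<le> u" "0 \<le> v" "u + v = 1"
  then have pos: "0 < f x" "0 < f y" using e by auto
  have "ln e = u * ln e + v * ln e" using uv by (simp flip: distrib_right)
  also have "\<dots> \<le> u * ln (f x) + v * ln (f y)"
    using xy e uv by (intro add_mono mult_left_mono) auto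
  also have "\<dots> \<le> ln (f (u *\<^sub>R x + v *\<^sub>R y))"
    using f pos uv by (rule log_concave_ln(2))
  finally show "u *\<^sub>R x + v *\<^sub>R y \<in> {x. e \<le> f x}"
    using e log_concave_ln(1)[OF f pos uv] by simp
qed

text \<open>The set where \<open>f\<close> is nonzero is a countable union of convex superlevel
  sets. Convex sets with empty interior are negligible, so if none had interior the integral would
  vanish.\<close>

lemma log_concave_superlevel_cball:
  fixes f :: "'a::euclidean_space \<Rightarrow> real"
  assumes nonneg: "\<And>x. 0 \<le> f x" and f: "log_concave f"
    and int: "integrable lborel f" and pos: "0 < (\<integral>x. f x \<partial>lborel)"
  obtains x\<^sub>0 r e where "0 < r" "0 < e" "\<And>x. x \<in> cball x\<^sub>0 r \<Longrightarrow> e \<le> f x"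
proof -
  define S where "S n = {x. 1 / Suc n \<le> f x}" for n
  have "\<exists>n. interior (S n) \<noteq> {}"
  proof (rule ccontr)
    assume "\<nexists>n. interior (S n) \<noteq> {}"
    then have "negligible (S n)" for n
      using negligible_convex_interior[of "S n"] convex_superlevel_log_concave[OF f, of "1 / Suc n"]
      by (simp add: S_def)
    then have "negligible (\<Union>n. S n)" by (intro negligible_countable_Union) auto
    moreover have "{x. f x \<noteq> 0} \<subseteq> (\<Union>n. S n)"
    proof
      fix x assume "x \<in> {x. f x \<noteq> 0}"
      then have "0 < f x" using nonneg[of x] by (simp add: order.strict_iff_order)
      then obtain n where "inverse (real (Suc n)) < f x" using reals_Archimedean by blast
      then show "x \<in> (\<Union>n. S n)" by (auto simp: S_def inverse_eq_divide intro!: exI[of _ n])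
    qed
    ultimately have "AE x in lebesgue. f x = 0"
      by (intro AE_I'[of "\<Union>n. S n"]) (auto simp: negligible_iff_null_sets)
    then have "(\<integral>x. f x \<partial>lebesgue) = 0" by (rule integral_eq_zero_AE)
    then show False using pos int by (simp add: integral_completion)
  qed
  then obtain n z where "z \<in> interior (S n)" by blast
  then obtain r where "0 < r" "cball z r \<subseteq> S n" by (meson mem_interior_cball)
  then show ?thesis by (intro that[of r "1 / Suc n" z]) (auto simp: S_def)
qed

text \<open>Points with \<open>f (x n) > n\<close> would accumulate at some \<open>l\<close>, near
  which \<open>f\<close> stays below \<open>f l + 1\<close>.\<close>

lemma upper_semicontinuous_bounded_above:
  fixes f :: "'a::heine_borel \<Rightarrow> real"
  assumes f: "upper_semicontinuous f" and S: "compact S"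
  obtains M where "\<And>x. x \<in> S \<Longrightarrow> f x \<le> M"
proof (rule ccontr)
  assume "\<not> thesis"
  then have "\<exists>x\<in>S. real n < f x" for n using that by (meson not_le)
  then obtain x where x: "x n \<in> S" "real n < f (x n)" for n by metis
  obtain l r where r: "strict_mono r" "(x \<circ> r) \<longlonglongrightarrow> l"
    using S x(1) unfolding compact_def by metis
  have "\<forall>\<^sub>F z in nhds l. f z < f l + 1" using f by (simp add: upper_semicontinuous_def)
  then have "\<forall>\<^sub>F n in sequentially. f ((x \<circ> r) n) < f l + 1"
    using r(2) by (rule eventually_compose_filterlim)
  moreover have "\<forall>\<^sub>F n in sequentially. f l + 1 \<le> real n"
    by (rule eventually_ge_at_top[THEN filterlim_real_sequentially[unfolded filterlim_iff, rule_format]])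
  ultimately have "\<forall>\<^sub>F n in sequentially. False"
  proof eventually_elim
    case (elim n)
    then show False using x(2)[of "r n"] seq_suble[OF r(1), of n] by simp
  qed
  then show False by simp
qed

text \<open>A point where \<open>f\<close> is not small, far away from the ball, would give \<open>f\<close> a definite mass on the
  ball of half the radius around the midpoint.\<close>

lemma log_concave_small_far_away:
  fixes f :: "'a::euclidean_space \<Rightarrow> real"
  assumes nonneg: "\<And>x. 0 \<le> f x" and f: "log_concave f" and int: "integrable lborel f"
    and ball: "0 < r" "0 < e" "\<And>x. x \<in> cball x\<^sub>0 r \<Longrightarrow> e \<le> f x"
  obtains D where "0 < D" "\<And>y. D \<le> norm (y - x\<^sub>0) \<Longrightarrow> f y < e"
proof -
  define T where "T n = {x. real n < norm (x - x\<^sub>0)}" for n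
  have T [measurable]: "T n \<in> sets borel" for n unfolding T_def by measurable
  have [measurable]: "f \<in> borel_measurable borel" using int by auto
  have tail: "(\<lambda>n. \<integral>x. indicator (T n) x * f x \<partial>lborel) \<longlonglongrightarrow> (\<integral>(x::'a). 0 \<partial>lborel)"
  proof (rule integral_dominated_convergence[where w = f])
    show "AE x in lborel. (\<lambda>n. indicator (T n) x * f x) \<longlonglongrightarrow> 0"
    proof (rule AE_I2)
      fix x
      obtain N where "norm (x - x\<^sub>0) \<le> real N" using real_arch_simple by blast
      then have "\<forall>\<^sub>F n in sequentially. indicator (T n) x * f x = 0"
        by (intro eventually_sequentiallyI[of N]) (auto simp: T_def indicator_def)
      then show "(\<lambda>n. indicator (T n) x * f x) \<longlonglongrightarrow> 0" by (rule tendsto_eventually)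
    qed
    show "AE x in lborel. norm (indicator (T n) x * f x) \<le> f x" for n
      using nonneg by (auto simp: indicator_def)
  qed (use int in auto)
  \<comment> \<open>A lower bound for the mass of \<open>f\<close> on a ball of radius
    \<open>r / 2\<close> where \<open>f\<close> is at least \<open>e\<close>; \<open>n\<close> makes
    the tail of the integral smaller.\<close>
  define c where "c = e * measure lborel (cball (0::'a) (r / 2))"
  have c: "0 < c" using ball by (simp add: c_def content_cball_pos)
  obtain n where n: "(\<integral>x. indicator (T n) x * f x \<partial>lborel) < c"
    using order_tendstoD(2)[OF tail, of c] c by (auto simp: eventually_sequentially)
  \<comment> \<open>At this distance the midpoint is at least \<open>n + r\<close> away from
    \<open>x\<^sub>0\<close>, so the ball of radius \<open>r / 2\<close> around it lies in
    \<open>T n\<close>.\<close>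
  show ?thesis
  proof (rule that[of "2 * (real n + r)"])
    fix y assume y: "2 * (real n + r) \<le> norm (y - x\<^sub>0)"
    show "f y < e"
    proof (rule ccontr)
      assume "\<not> f y < e"
      then have fy: "e \<le> f y" by simp
      define m where "m = (1 / 2) *\<^sub>R (x\<^sub>0 + y)"
      have le: "e * indicator (cball m (r / 2)) z \<le> indicator (T n) z * f z" for z
      proof (cases "z \<in> cball m (r / 2)")
        case True
        then have z: "norm (z - m) \<le> r / 2" by (simp add: dist_norm norm_minus_commute)
        \<comment> \<open>\<open>z\<close> is the midpoint of \<open>y\<close> and this point of the
          original ball.\<close>
        have "x\<^sub>0 + 2 *\<^sub>R (z - m) \<in> cball x\<^sub>0 r" using z by (simp add: dist_norm)
        then have "x\<^sub>0 + 2 *\<^sub>R (z - m) \<in> {x. e \<le> f x}" using ball(3) by simp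
        moreover have "y \<in> {x. e \<le> f x}" using fy by simp
        ultimately have "(1 / 2) *\<^sub>R (x\<^sub>0 + 2 *\<^sub>R (z - m)) + (1 / 2) *\<^sub>R y \<in> {x. e \<le> f x}"
          by (intro convexD[OF convex_superlevel_log_concave[OF f ball(2)]]) auto
        also have "(1 / 2) *\<^sub>R (x\<^sub>0 + 2 *\<^sub>R (z - m)) + (1 / 2) *\<^sub>R y = z"
          by (simp add: m_def algebra_simps)
        finally have "e \<le> f z" by simp
        moreover have "z \<in> T n"
        proof -
          have "m - x\<^sub>0 = (1 / 2) *\<^sub>R (y - x\<^sub>0)"
            by (simp add: m_def algebra_simps flip: scaleR_add_left)
          then have "norm (m - x\<^sub>0) = norm (y - x\<^sub>0) / 2" by simp
          moreover have "norm (m - x\<^sub>0) \<le> norm (z - x\<^sub>0) + norm (z - m)"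
            by (metis norm_minus_commute norm_triangle_sub add.commute diff_add_cancel norm_triangle_ineq add_diff_eq)
          ultimately show ?thesis using y z ball(1) by (simp add: T_def)
        qed
        ultimately show ?thesis using True by simp
      qed (use nonneg in simp)
      have "c = (\<integral>z. e * indicator (cball m (r / 2)) z \<partial>lborel)"
        using ball by (simp add: c_def content_cball)
      also have "\<dots> \<le> (\<integral>z. indicator (T n) z * f z \<partial>lborel)"
      proof (rule integral_mono)
        show "integrable lborel (\<lambda>z. e * indicator (cball m (r / 2)) z)"
          using emeasure_lborel_cball_finite[of m "r / 2"]
          by (intro integrable_mult_right) (simp add: integrable_indicator_iff)
        show "integrable lborel (\<lambda>z. indicator (T n) z * f z)"
          using integrable_mult_indicator[OF _ int, of "T n"] by simp
      qed (rule le)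
      finally show False using n by simp
    qed
  qed (use ball in simp)
qed

text \<open>At distance \<open>D\<close> from \<open>x\<^sub>0\<close> the logarithm of
  \<open>f\<close> has dropped below \<open>ln e\<close> by at least 1; concavity along rays then
  forces a decay rate of at least \<open>1 / D\<close> further out.\<close>

lemma log_concave_exponential_decay:
  fixes f :: "'a::euclidean_space \<Rightarrow> real"
  assumes nonneg: "\<And>x. 0 \<le> f x" and usc: "upper_semicontinuous f" and f: "log_concave f"
    and int: "integrable lborel f" and pos: "0 < (\<integral>x. f x \<partial>lborel)"
  obtains K c a where "0 < K" "0 < c" "\<And>x. f x \<le> K * exp (- c * norm (x - a))"
proof -
  obtain x\<^sub>0 r e where ball: "0 < r" "0 < e" "\<And>x. x \<in> cball x\<^sub>0 r \<Longrightarrow> e \<le> f x"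
    by (rule log_concave_superlevel_cball[OF nonneg f int pos], rule that)
  have fx0: "e \<le> f x\<^sub>0" using ball by simp
  obtain D where D: "0 < D" "\<And>y. D \<le> norm (y - x\<^sub>0) \<Longrightarrow> f y < e * exp (-1)"
  proof (rule log_concave_small_far_away[OF nonneg f int ball(1), of "e * exp (-1)" x\<^sub>0])
    show "e * exp (- 1) \<le> f x" if "x \<in> cball x\<^sub>0 r" for x
      using ball(2) ball(3)[OF that] by (smt (verit) exp_le_one_iff mult_left_le)
  qed (use ball in auto)
  obtain M where M: "\<And>x. x \<in> cball x\<^sub>0 D \<Longrightarrow> f x \<le> M"
    using upper_semicontinuous_bounded_above[OF usc, of "cball x\<^sub>0 D"] by auto
  \<comment> \<open>The first entry serves the points beyond distance \<open>D\<close>, the second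
    the ball, where the exponential is at least \<open>exp (- 1)\<close>.\<close>
  define K where "K = max e (M * exp 1)"
  have "f x \<le> K * exp (- (1 / D) * norm (x - x\<^sub>0))" for x
  proof (cases "D \<le> norm (x - x\<^sub>0)")
    case far: True
    show ?thesis
    proof (cases "f x = 0")
      case False
      then have fx: "0 < f x" using nonneg[of x] by simp
      define l where "l = D / norm (x - x\<^sub>0)"
      have l: "0 < l" "l \<le> 1" unfolding l_def
        using D(1) far by (auto intro!: divide_pos_pos simp: divide_le_eq simp del: zero_less_norm_iff)
      \<comment> \<open>The point at distance \<open>D\<close> on the segment from
        \<open>x\<^sub>0\<close> to \<open>x\<close>.\<close>
      define y where "y = (1 - l) *\<^sub>R x\<^sub>0 + l *\<^sub>R x"
      have "x \<noteq> x\<^sub>0" using D(1) far by auto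
      moreover have "y - x\<^sub>0 = l *\<^sub>R (x - x\<^sub>0)" by (simp add: y_def algebra_simps)
      ultimately have "norm (y - x\<^sub>0) = D" using l D(1) far by (simp add: l_def)
      then have fy: "f y < e * exp (-1)" using D(2) by simp
      have "0 < f x\<^sub>0" using fx0 ball(2) by simp
      note lc = log_concave_ln[OF f this fx, of "1 - l" l, folded y_def]
      have "(1 - l) * ln e + l * ln (f x) \<le> (1 - l) * ln (f x\<^sub>0) + l * ln (f x)"
        using l fx0 ball(2) by (intro add_right_mono mult_left_mono) auto
      also have "\<dots> \<le> ln (f y)" using lc l by simp
      also have "\<dots> < ln (e * exp (-1))" using lc(1) l fy ball(2) by simp
      also have "\<dots> = ln e - 1" using ball(2) by (simp add: ln_mult)
      finally have "ln (f x) < ln e - 1 / l" using l by (simp add: field_simps)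
      then have "f x < exp (ln e - 1 / l)" using fx by (metis exp_less_cancel_iff exp_ln)
      also have "\<dots> = e * exp (- (1 / D) * norm (x - x\<^sub>0))"
        using ball(2) by (simp add: l_def exp_diff exp_minus divide_inverse)
      also have "\<dots> \<le> K * exp (- (1 / D) * norm (x - x\<^sub>0))"
        by (simp add: K_def)
      finally show ?thesis by simp
    qed (use ball in \<open>simp add: K_def less_imp_le le_max_iff_disj\<close>)
  next
    case False
    then have "f x \<le> M * exp 1 * exp (- 1)"
      using M[of x] by (simp add: dist_norm norm_minus_commute flip: exp_add mult.assoc)
        (simp add: mult.assoc flip: exp_add)
    also have "\<dots> \<le> K * exp (- 1)" by (simp add: K_def)
    also have "\<dots> \<le> K * exp (- (1 / D) * norm (x - x\<^sub>0))"
      using False D(1) ball(2) by (intro mult_left_mono) (auto simp: K_def field_simps)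
    finally show ?thesis .
  qed
  moreover have "0 < K" using ball(2) by (simp add: K_def less_max_iff_disj)
  ultimately show ?thesis using that[of K "1 / D" x\<^sub>0] D(1) by simp
qed

subsection \<open>Compactness and existence\<close>

lemma tendsto_det:
  fixes A :: "'a \<Rightarrow> real^'n^'n"
  assumes "(A \<longlongrightarrow> B) F"
  shows "((\<lambda>x. det (A x)) \<longlongrightarrow> det B) F"
  unfolding det_def by (intro tendsto_intros tendsto_vec_nth assms)

lemma tendsto_matrix_vector_mult:
  fixes A :: "'a \<Rightarrow> real^'n^'m"
  assumes "(A \<longlongrightarrow> B) F" "(x \<longlongrightarrow> y) F"
  shows "((\<lambda>t. A t *v x t) \<longlongrightarrow> B *v y) F"
  unfolding matrix_vector_mult_def
  by (intro tendsto_vec_lambda tendsto_sum tendsto_mult tendsto_vec_nth assms)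

lemma tendsto_ell:
  fixes A :: "nat \<Rightarrow> real^'n^'n"
  assumes "s \<longlonglongrightarrow> \<sigma>" "\<And>n. 0 \<le> s n" "\<alpha> \<longlonglongrightarrow> \<alpha>'" "A \<longlonglongrightarrow> A'" "b \<longlonglongrightarrow> b'" "x \<longlonglongrightarrow> x'"
  shows "(\<lambda>n. ell (s n) (\<alpha> n) (A n) (b n) (x n)) \<longlonglongrightarrow> ell \<sigma> \<alpha>' A' b' x'"
  unfolding ell_def
  by (intro tendsto_intros tendsto_psi tendsto_matrix_vector_mult assms) auto

lemma ell_le:
  assumes "0 \<le> s" "0 \<le> \<alpha>"
  shows "ell s \<alpha> A b x \<le> \<alpha> * exp (s * (1 + ln 2)) * exp (- (1 / 2) * norm (A *v x + b))"
  unfolding ell_def mult.assoc using assms by (intro mult_left_mono exp_minus_psi_le) auto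

text \<open>Termwise estimate of the Leibniz formula, whose terms are indexed by
  permutations.\<close>

lemma abs_det_le:
  fixes A :: "real^'n^'n"
  assumes "\<And>i j. \<bar>A $ i $ j\<bar> \<le> m"
  shows "\<bar>det A\<bar> \<le> fact CARD('n) * m ^ CARD('n)"
proof -
  have "\<bar>det A\<bar> \<le> (\<Sum>p | p permutes (UNIV :: 'n set). \<bar>of_int (sign p) * (\<Prod>i\<in>UNIV. A $ i $ p i)\<bar>)"
    unfolding det_def by (rule sum_abs)
  also have "\<dots> \<le> (\<Sum>p | p permutes (UNIV :: 'n set). m ^ CARD('n))"
  proof (rule sum_mono)
    fix p :: "'n \<Rightarrow> 'n"
    have "\<bar>of_int (sign p) * (\<Prod>i\<in>UNIV. A $ i $ p i)\<bar> = (\<Prod>i\<in>UNIV. \<bar>A $ i $ p i\<bar>)"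
      by (simp add: abs_mult abs_prod sign_def)
    also have "\<dots> \<le> (\<Prod>i\<in>(UNIV :: 'n set). m)"
      using assms by (intro prod_mono) auto
    finally show "\<bar>of_int (sign p) * (\<Prod>i\<in>UNIV. A $ i $ p i)\<bar> \<le> m ^ CARD('n)" by simp
  qed
  also have "\<dots> = fact CARD('n) * m ^ CARD('n)"
    by (simp add: card_permutations)
  finally show ?thesis .
qed

lemma exp_dominates_power:
  fixes C :: real
  obtains Y where "\<And>y. exp y \<le> C * y ^ k \<Longrightarrow> y \<le> Y"
proof -
  have "((\<lambda>y::real. C * (y ^ k / exp y)) \<longlongrightarrow> C * 0) at_top"
    by (intro tendsto_intros tendsto_power_div_exp_0)
  then have "\<forall>\<^sub>F y in at_top. C * (y ^ k / exp y) < 1"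
    by (rule order_tendstoD) simp
  then obtain Y where Y: "\<And>y. Y \<le> y \<Longrightarrow> C * (y ^ k / exp y) < 1"
    by (auto simp: eventually_at_top_linorder)
  have "y \<le> Y" if "exp y \<le> C * y ^ k" for y
  proof (rule ccontr)
    assume "\<not> y \<le> Y"
    then have "C * (y ^ k / exp y) < 1" using Y by simp
    then have "C * y ^ k < exp y" by (simp add: field_simps)
    then show False using that by simp
  qed
  with that show ?thesis by blast
qed

text \<open>On the ball a candidate is at least \<open>e\<close>, so \<open>norm (A x + b)\<close> is there at most linear in
  \<open>ln \<alpha>\<close>; hence \<open>\<alpha> \<le> C * \<bar>det A\<bar>\<close> grows at most like a power of \<open>ln \<alpha>\<close>, which bounds \<open>\<alpha>\<close>.\<close>

lemma feasible_parameters_bounded: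
  fixes f :: "real^'n \<Rightarrow> real"
  assumes ball: "0 < r" "0 < e" "\<And>x. x \<in> cball x\<^sub>0 r \<Longrightarrow> e \<le> f x" and C: "0 < C"
  obtains P where "\<And>s \<alpha> A b. 0 \<le> s \<Longrightarrow> s \<le> S \<Longrightarrow> feasible s f \<alpha> A b \<Longrightarrow> \<alpha> / \<bar>det A\<bar> \<le> C \<Longrightarrow>
    e \<le> \<alpha> \<and> \<alpha> \<le> P \<and> norm A \<le> P \<and> norm b \<le> P"
proof -
  \<comment> \<open>Bounds the correction \<open>s * (1 + ln 2)\<close> from
    \<open>exp_minus_psi_le\<close> uniformly for \<open>s \<le> S\<close>.\<close>
  define K where "K = S * (1 + ln 2)"
  define G where "G = C * (fact CARD('n) * (2 / r) ^ CARD('n)) / (e * exp (- K))"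
  obtain Y where Y: "\<And>y. exp y \<le> G * y ^ CARD('n) \<Longrightarrow> y \<le> Y"
    using exp_dominates_power by blast
  define P where "P = max (e * exp Y) (max (real CARD('n) * (real CARD('n) * (2 * Y / r))) (2 * Y + norm x\<^sub>0 / r * (2 * Y)))"
  have "e \<le> \<alpha> \<and> \<alpha> \<le> P \<and> norm A \<le> P \<and> norm b \<le> P"
    if s: "0 \<le> s" "s \<le> S" and fe: "feasible s f \<alpha> A b" and le: "\<alpha> / \<bar>det A\<bar> \<le> C" for s \<alpha> A b
  proof -
    have \<alpha>: "0 < \<alpha>" and A: "invertible A" and fl: "\<And>x. f x \<le> ell s \<alpha> A b x"
      using fe by (auto simp: feasible_def)
    have sK: "s * (1 + ln 2) \<le> K" unfolding K_def using s by (intro mult_right_mono) auto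
    have x0: "x\<^sub>0 \<in> cball x\<^sub>0 r" using ball by simp
    have "e \<le> \<alpha> * exp (- psi s (norm (A *v x\<^sub>0 + b)))"
      using ball(3)[OF x0] fl[of x\<^sub>0] by (simp add: ell_def)
    also have "\<dots> \<le> \<alpha> * 1" using \<alpha> psi_nonneg[OF s(1)] by (intro mult_left_mono) auto
    finally have e\<alpha>: "e \<le> \<alpha>" by simp
    \<comment> \<open>Chosen so that \<open>\<alpha> = e * exp (y - K)\<close> and
      \<open>2 * y\<close> bounds \<open>norm (A *v x + b)\<close> on the ball.\<close>
    define y where "y = ln (\<alpha> / e) + K"
    have K0: "0 \<le> K" using s unfolding K_def by simp
    then have y0: "0 \<le> y" using e\<alpha> ball(2) by (simp add: y_def)
    have aff: "norm (A *v x + b) \<le> 2 * y" if "x \<in> cball x\<^sub>0 r" for x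
    proof -
      have "e \<le> ell s \<alpha> A b x" using ball(3)[OF that] fl[of x] by simp
      also have "\<dots> \<le> \<alpha> * exp (s * (1 + ln 2)) * exp (- (1 / 2) * norm (A *v x + b))"
        using \<alpha> s by (intro ell_le) auto
      finally have "ln e \<le> ln (\<alpha> * exp (s * (1 + ln 2)) * exp (- (1 / 2) * norm (A *v x + b)))"
        using ball(2) \<alpha> by simp
      also have "\<dots> = ln \<alpha> + s * (1 + ln 2) - norm (A *v x + b) / 2"
        using \<alpha> by (simp add: ln_mult)
      finally show ?thesis using sK \<alpha> ball(2) by (simp add: y_def ln_div)
    qed
    have lin: "norm (A *v h) \<le> norm h / r * (2 * y)" for h
    proof (cases "h = 0")
      case False
      \<comment> \<open>Rescaled to length \<open>r\<close>, so that \<open>x\<^sub>0 + k\<close>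
        and \<open>x\<^sub>0 - k\<close> stay in the ball; their difference eliminates
        \<open>b\<close>.\<close>
      define k where "k = (r / norm h) *\<^sub>R h"
      have "norm k = r" using False ball(1) by (simp add: k_def)
      then have "norm (A *v (x\<^sub>0 + k) + b) \<le> 2 * y" "norm (A *v (x\<^sub>0 - k) + b) \<le> 2 * y"
        by (auto intro!: aff simp: dist_norm)
      then have "norm ((A *v (x\<^sub>0 + k) + b) - (A *v (x\<^sub>0 - k) + b)) \<le> 2 * y + 2 * y"
        by (intro norm_triangle_le_diff add_mono)
      also have "(A *v (x\<^sub>0 + k) + b) - (A *v (x\<^sub>0 - k) + b) = 2 *\<^sub>R (A *v k)"
        by (simp add: matrix_vector_right_distrib matrix_vector_mult_diff_distrib scaleR_2)
      finally have "norm (A *v k) \<le> 2 * y" by simp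
      moreover have "norm (A *v k) = r / norm h * norm (A *v h)"
        using ball(1) by (simp add: k_def matrix_vector_mult_scaleR)
      ultimately show ?thesis using False ball(1) by (simp add: field_simps)
    qed simp
    have entry: "\<bar>A $ i $ j\<bar> \<le> 2 * y / r" for i j
    proof -
      have "\<bar>A $ i $ j\<bar> = \<bar>(A *v axis j 1) $ i\<bar>" 
        by (simp add: matrix_vector_mult_basis column_def)
      also have "\<dots> \<le> norm (A *v axis j 1)" by (rule component_le_norm_cart)
      also have "\<dots> \<le> 2 * y / r" using lin[of "axis j 1"] by simp
      finally show ?thesis .
    qed
    have d: "0 < \<bar>det A\<bar>" using A by (simp add: invertible_det_nz)
    have "\<alpha> \<le> C * \<bar>det A\<bar>" using le d by (simp add: field_simps)
    also have "\<dots> \<le> C * (fact CARD('n) * (2 * y / r) ^ CARD('n))"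
      using C by (intro mult_left_mono abs_det_le entry) auto
    also have "(2 * y / r) ^ CARD('n) = (2 / r) ^ CARD('n) * y ^ CARD('n)"
      by (simp add: power_mult_distrib flip: times_divide_eq_left)
    finally have "\<alpha> \<le> C * (fact CARD('n) * (2 / r) ^ CARD('n)) * y ^ CARD('n)" by (simp add: mult_ac)
    moreover have "\<alpha> = e * exp (- K) * exp y"
      using \<alpha> ball(2) by (simp add: y_def exp_add exp_minus exp_ln)
    ultimately have "e * exp (- K) * exp y \<le> C * (fact CARD('n) * (2 / r) ^ CARD('n)) * y ^ CARD('n)"
      by simp
    moreover have "z \<le> X / g * w" if "g * z \<le> X * w" "0 < g" for g X z w :: real
      using that by (simp add: field_simps)
    ultimately have "exp y \<le> G * y ^ CARD('n)"
      using ball(2) by (simp add: G_def)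
    then have yY: "y \<le> Y" by (rule Y)
    have "\<alpha> = e * exp (y - K)" using \<alpha> ball(2) by (simp add: y_def)
    also have "\<dots> \<le> e * exp Y" using yY K0 ball(2) by simp
    finally have "\<alpha> \<le> P" by (simp add: P_def)
    moreover have "norm A \<le> P"
    proof -
      have yr: "2 * y / r \<le> 2 * Y / r" using yY ball(1) by (simp add: divide_right_mono)
      have "norm A \<le> (\<Sum>i\<in>UNIV. norm (A $ i))" unfolding norm_vec_def by (rule L2_set_le_sum) simp
      also have "\<dots> \<le> (\<Sum>i\<in>(UNIV :: 'n set). \<Sum>j\<in>(UNIV :: 'n set). 2 * Y / r)"
        by (intro sum_mono order_trans[OF norm_le_l1_cart] order_trans[OF entry yr])
      also have "\<dots> = real CARD('n) * (real CARD('n) * (2 * Y / r))" by simp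
      also have "\<dots> \<le> P" by (simp add: P_def)
      finally show ?thesis .
    qed
    moreover have "norm b \<le> P"
    proof -
      have "norm b \<le> norm (A *v x\<^sub>0 + b) + norm (A *v x\<^sub>0)"
        using norm_triangle_ineq4[of "A *v x\<^sub>0 + b" "A *v x\<^sub>0"] by simp
      also have "\<dots> \<le> 2 * y + norm x\<^sub>0 / r * (2 * y)" by (intro add_mono aff x0 lin)
      also have "\<dots> \<le> 2 * Y + norm x\<^sub>0 / r * (2 * Y)"
        using yY ball(1) by (intro add_mono mult_left_mono) auto
      also have "\<dots> \<le> P" by (simp add: P_def)
      finally show ?thesis .
    qed
    ultimately show ?thesis using e\<alpha> by blast
  qed
  with that show ?thesis by blast
qed

text \<open>\<open>feasible_parameters_bounded\<close> gives convergent parameters, and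
  \<open>\<alpha> n \<ge> e\<close> keeps the limit nondegenerate: height and determinant stay away
  from 0. The pointwise inequality passes to the limit by \<open>tendsto_ell\<close>, even with
  varying \<open>s\<close>.\<close>

lemma feasible_subsequence:
  fixes f :: "real^'n \<Rightarrow> real" and A :: "nat \<Rightarrow> real^'n^'n"
  assumes ball: "0 < r" "0 < e" "\<And>x. x \<in> cball x\<^sub>0 r \<Longrightarrow> e \<le> f x"
    and s: "\<And>n. 0 \<le> s n" "s \<longlonglongrightarrow> \<sigma>"
    and fe: "\<And>n. feasible (s n) f (\<alpha> n) (A n) (b n)" and C: "\<And>n. \<alpha> n / \<bar>det (A n)\<bar> \<le> C"
  obtains k \<alpha>' A' b' where "strict_mono k" "(\<alpha> \<circ> k) \<longlonglongrightarrow> \<alpha>'" "(A \<circ> k) \<longlonglongrightarrow> A'" "(b \<circ> k) \<longlonglongrightarrow> b'"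
    "feasible \<sigma> f \<alpha>' A' b'"
proof -
  have "\<alpha> 0 / \<bar>det (A 0)\<bar> > 0" using fe[of 0] by (simp add: feasible_def invertible_det_nz)
  then have Cpos: "0 < C" using C[of 0] by simp
  obtain S where S: "\<And>n. s n \<le> S"
    using convergent_imp_Bseq[of s] s(2) unfolding Bseq_def convergent_def
    by (metis abs_le_D1 real_norm_def)
  obtain P where P: "\<And>s \<alpha> A b. 0 \<le> s \<Longrightarrow> s \<le> S \<Longrightarrow> feasible s f \<alpha> A b \<Longrightarrow> \<alpha> / \<bar>det A\<bar> \<le> C \<Longrightarrow>
    e \<le> \<alpha> \<and> \<alpha> \<le> P \<and> norm A \<le> P \<and> norm b \<le> P"
    using feasible_parameters_bounded[of r e x\<^sub>0 f C S, OF ball Cpos] by blast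
  note Pn = P[OF s(1) S fe C]
  have "bounded (range (\<lambda>n. (\<alpha> n, A n, b n)))"
  proof (rule bounded_subset)
    show "bounded (cball 0 P \<times> cball (0 :: real^'n^'n) P \<times> cball (0 :: real^'n) P)"
      by (intro bounded_Times) auto
    show "range (\<lambda>n. (\<alpha> n, A n, b n)) \<subseteq> cball 0 P \<times> cball 0 P \<times> cball 0 P"
    proof (rule image_subsetI)
      fix n
      show "(\<alpha> n, A n, b n) \<in> cball 0 P \<times> cball 0 P \<times> cball 0 P"
        using Pn[of n] ball(2) by auto
    qed
  qed
  then obtain l k where k: "strict_mono k" "((\<lambda>n. (\<alpha> n, A n, b n)) \<circ> k) \<longlonglongrightarrow> l"
    using bounded_imp_convergent_subsequence by blast
  obtain \<alpha>' A' b' where l: "l = (\<alpha>', A', b')" by (cases l) auto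
  have lim: "(\<alpha> \<circ> k) \<longlonglongrightarrow> \<alpha>'" "(A \<circ> k) \<longlonglongrightarrow> A'" "(b \<circ> k) \<longlonglongrightarrow> b'"
    using tendsto_fst[OF k(2)] tendsto_fst[OF tendsto_snd[OF k(2)]] tendsto_snd[OF tendsto_snd[OF k(2)]]
    by (simp_all add: l comp_def)
  have "e \<le> \<alpha>'" using LIMSEQ_le_const[OF lim(1)] Pn by auto
  then have \<alpha>': "0 < \<alpha>'" using ball(2) by simp
  \<comment> \<open>A bounded value with height at least \<open>e\<close> prevents the determinant
    from collapsing.\<close>
  have "e / C \<le> \<bar>det (A n)\<bar>" for n
  proof -
    have "e \<le> \<alpha> n" using Pn by blast
    also have "\<dots> \<le> C * \<bar>det (A n)\<bar>"
      using C[of n] fe[of n] by (simp add: feasible_def invertible_det_nz field_simps)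
    finally show ?thesis using Cpos by (simp add: field_simps)
  qed
  then have "e / C \<le> \<bar>det A'\<bar>"
    using LIMSEQ_le_const[OF tendsto_rabs[OF tendsto_det[OF lim(2)]]] by auto
  moreover have "0 < e / C" using ball(2) Cpos by simp
  ultimately have A': "invertible A'" by (auto simp: invertible_det_nz)
  have "f x \<le> ell \<sigma> \<alpha>' A' b' x" for x
  proof (rule LIMSEQ_le_const)
    show "(\<lambda>n. ell ((s \<circ> k) n) ((\<alpha> \<circ> k) n) ((A \<circ> k) n) ((b \<circ> k) n) x) \<longlonglongrightarrow> ell \<sigma> \<alpha>' A' b' x"
      using s k(1) by (intro tendsto_ell lim LIMSEQ_subseq_LIMSEQ tendsto_const) auto
    show "\<exists>N. \<forall>n\<ge>N. f x \<le> ell ((s \<circ> k) n) ((\<alpha> \<circ> k) n) ((A \<circ> k) n) ((b \<circ> k) n) x"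
      using fe by (auto simp: feasible_def)
  qed
  with that k(1) lim \<alpha>' A' show ?thesis by (simp add: feasible_def)
qed

section \<open>Existence of optimal parameters\<close>

lemma feasible_value_tendsto:
  fixes A :: "nat \<Rightarrow> real^'n^'n"
  assumes "\<alpha> \<longlonglongrightarrow> \<alpha>'" "A \<longlonglongrightarrow> A'" "invertible A'"
  shows "(\<lambda>n. \<alpha> n / \<bar>det (A n)\<bar>) \<longlonglongrightarrow> \<alpha>' / \<bar>det A'\<bar>"
  using assms by (intro tendsto_intros tendsto_det) (auto simp: invertible_det_nz)

text \<open>Since \<open>psi s t \<le> t\<close>, candidates only grow when \<open>s = 0\<close> is
  replaced by \<open>s\<close>. This bounds the optimal values for all \<open>s\<close> by the one
  for \<open>s = 0\<close>.\<close>

lemma feasible_zero_imp_feasible: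
  assumes "0 \<le> s" "feasible 0 f \<alpha> A b"
  shows "feasible s f \<alpha> A b"
proof -
  have "ell 0 \<alpha> A b x \<le> ell s \<alpha> A b x" for x
    using assms psi_le[of s] by (simp add: ell_def feasible_def)
  with assms show ?thesis by (auto simp: feasible_def intro: order_trans)
qed

text \<open>Exponential decay of \<open>f\<close> supplies a feasible candidate with a scalar
  matrix; a minimizing sequence then converges along a subsequence by
  \<open>feasible_subsequence\<close>.\<close>

lemma exists_optimal:
  fixes f :: "real^'n \<Rightarrow> real"
  assumes nonneg: "\<And>x. 0 \<le> f x" and usc: "upper_semicontinuous f" and f: "log_concave f"
    and int: "integrable lborel f" and pos: "0 < (\<integral>x. f x \<partial>lborel)" and s: "0 \<le> s"
  shows "\<exists>\<alpha> A b. optimal s f \<alpha> A b"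
proof -
  define V where "V = {\<alpha> / \<bar>det A\<bar> | \<alpha> A. \<exists>b. feasible s f \<alpha> A b}"
  obtain K c a where K: "0 < K" "0 < c" "\<And>x. f x \<le> K * exp (- c * norm (x - a))"
    by (rule log_concave_exponential_decay[OF nonneg usc f int pos], rule that)
  have "diag_matrix (\<lambda>_. c) *v x + (- c *\<^sub>R a) = c *\<^sub>R (x - a)" for x
    by (simp add: vec_eq_iff algebra_simps)
  then have "feasible 0 f K (diag_matrix (\<lambda>_. c)) (- c *\<^sub>R a)"
    using K by (simp add: feasible_def invertible_det_nz ell_def)
  then have "feasible s f K (diag_matrix (\<lambda>_. c)) (- c *\<^sub>R a)"
    by (rule feasible_zero_imp_feasible[OF s])
  then have ne: "V \<noteq> {}" by (auto simp: V_def)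
  have bdd: "bdd_below V"
    by (rule bdd_belowI[of _ 0]) (auto simp: V_def feasible_def)
  have "\<exists>\<alpha> A b. feasible s f \<alpha> A b \<and> \<alpha> / \<bar>det A\<bar> < Inf V + 1 / Suc n" for n
  proof -
    have "Inf V < Inf V + 1 / Suc n" by simp
    from cInf_lessD[OF ne this] show ?thesis by (auto simp: V_def)
  qed
  then obtain \<alpha> A b where fe: "\<And>n. feasible s f (\<alpha> n) (A n) (b n)"
    and lt: "\<And>n. \<alpha> n / \<bar>det (A n)\<bar> < Inf V + 1 / Suc n"
    by metis
  have le: "\<alpha> n / \<bar>det (A n)\<bar> \<le> Inf V + 1" for n
    using lt[of n] by (rule order_trans[OF less_imp_le]) simp
  obtain x\<^sub>0 r e where ball: "0 < r" "0 < e" "\<And>x. x \<in> cball x\<^sub>0 r \<Longrightarrow> e \<le> f x"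
    by (rule log_concave_superlevel_cball[OF nonneg f int pos], rule that)
  obtain k \<alpha>' A' b' where k: "strict_mono k" "(\<alpha> \<circ> k) \<longlonglongrightarrow> \<alpha>'" "(A \<circ> k) \<longlonglongrightarrow> A'"
    and fe': "feasible s f \<alpha>' A' b'"
    by (rule feasible_subsequence[OF ball, where s = "\<lambda>_. s" and \<sigma> = s and \<alpha> = \<alpha> and A = A and b = b
          and C = "Inf V + 1"]) (use s fe le in \<open>auto intro: that\<close>)
  have "\<alpha>' / \<bar>det A'\<bar> \<le> Inf V + 0"
  proof (rule LIMSEQ_le)
    show "(\<lambda>n. (\<alpha> \<circ> k) n / \<bar>det ((A \<circ> k) n)\<bar>) \<longlonglongrightarrow> \<alpha>' / \<bar>det A'\<bar>"
      using k fe' unfolding comp_def by (intro feasible_value_tendsto) (auto simp: feasible_def)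
    show "(\<lambda>n. Inf V + 1 / Suc (k n)) \<longlonglongrightarrow> Inf V + 0"
      using LIMSEQ_subseq_LIMSEQ[OF LIMSEQ_Suc[OF lim_1_over_n] k(1)]
      by (intro tendsto_intros) (simp add: comp_def)
    show "\<exists>N. \<forall>n\<ge>N. (\<alpha> \<circ> k) n / \<bar>det ((A \<circ> k) n)\<bar> \<le> Inf V + 1 / Suc (k n)"
      using lt by (auto intro!: less_imp_le)
  qed
  moreover have "Inf V \<le> \<beta> / \<bar>det B\<bar>" if "feasible s f \<beta> B d" for \<beta> B d
    using that bdd by (intro cInf_lower) (auto simp: V_def)
  ultimately show ?thesis using fe' unfolding optimal_def by (metis add.right_neutral order_trans)
qed

text \<open>Multiplying \<open>A\<close> and \<open>b\<close> from the left by an orthogonal matrix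
  changes the parameters but not the function; \<open>optimal_unique\<close> compares functions and
  so resolves the definite description.\<close>

lemma Loewner_eq_ell:
  assumes s: "0 \<le> s" and opt: "optimal s f \<alpha> A b"
  shows "Loewner s f = ell s \<alpha> A b"
  unfolding Loewner_def
proof (rule the_equality)
  show "is_Loewner s f (ell s \<alpha> A b)" using is_Loewner_iff[OF s] opt by blast
  show "l = ell s \<alpha> A b" if l: "is_Loewner s f l" for l
  proof -
    obtain \<beta> B d where "optimal s f \<beta> B d" "l = ell s \<beta> B d"
      using l is_Loewner_iff[OF s] by blast
    then show ?thesis using optimal_unique[OF s _ opt] by simp
  qed
qed

subsection \<open>Uniform convergence\<close>

text \<open>In the bound \<open>ell_le\<close> the prefactors converge and the exponent tends to
  minus infinity.\<close>

lemma ell_tendsto_zero: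
  assumes s: "\<And>n. 0 \<le> s n" "s \<longlonglongrightarrow> \<sigma>" and \<alpha>: "\<And>n. 0 \<le> \<alpha> n" "\<alpha> \<longlonglongrightarrow> \<alpha>'"
    and lim: "filterlim (\<lambda>n. norm (A n *v x n + b n)) at_top sequentially"
  shows "(\<lambda>n. ell (s n) (\<alpha> n) (A n) (b n) (x n)) \<longlonglongrightarrow> 0"
proof (rule tendsto_sandwich[OF _ _ tendsto_const])
  show "\<forall>\<^sub>F n in sequentially. 0 \<le> ell (s n) (\<alpha> n) (A n) (b n) (x n)"
    using \<alpha>(1) by (simp add: ell_def)
  show "\<forall>\<^sub>F n in sequentially. ell (s n) (\<alpha> n) (A n) (b n) (x n)
      \<le> \<alpha> n * exp (s n * (1 + ln 2)) * exp (- (1 / 2) * norm (A n *v x n + b n))"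
    using s(1) \<alpha>(1) by (intro always_eventually allI ell_le)
  have "filterlim (\<lambda>n. 1 / 2 * norm (A n *v x n + b n)) at_top sequentially"
    by (rule filterlim_tendsto_pos_mult_at_top[OF tendsto_const _ lim]) simp
  then have "filterlim (\<lambda>n. - (1 / 2) * norm (A n *v x n + b n)) at_bot sequentially"
    by (simp add: filterlim_uminus_at_bot)
  then have lim0: "(\<lambda>n. exp (- (1 / 2) * norm (A n *v x n + b n))) \<longlonglongrightarrow> 0"
    by (rule filterlim_compose[OF exp_at_bot])
  show "(\<lambda>n. \<alpha> n * exp (s n * (1 + ln 2)) * exp (- (1 / 2) * norm (A n *v x n + b n))) \<longlonglongrightarrow> 0"
    using tendsto_mult[OF tendsto_mult[OF \<alpha>(2) tendsto_exp[OF tendsto_mult_right[OF s(2)]]] lim0]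
    by simp
qed

text \<open>Along a subsequence either \<open>x n\<close> converges or it escapes to infinity in a limiting direction,
  in which case both sequences of values tend to 0; rescaling by \<open>1 + norm (x n)\<close> makes both cases
  limits in a compact set.\<close>

lemma ell_common_limit:
  fixes A :: "nat \<Rightarrow> real^'n^'n" and x :: "nat \<Rightarrow> real^'n"
  assumes s: "\<And>n. 0 \<le> s n" "s \<longlonglongrightarrow> \<sigma>" and \<alpha>: "\<And>n. 0 \<le> \<alpha> n" "\<alpha> \<longlonglongrightarrow> \<alpha>'"
    and A: "A \<longlonglongrightarrow> A'" "invertible A'" and b: "b \<longlonglongrightarrow> b'"
  obtains j L where "strict_mono j"
    "(\<lambda>n. ell (s (j n)) (\<alpha> (j n)) (A (j n)) (b (j n)) (x (j n))) \<longlonglongrightarrow> L"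
    "(\<lambda>n. ell \<sigma> \<alpha>' A' b' (x (j n))) \<longlonglongrightarrow> L"
proof -
  have \<sigma>: "0 \<le> \<sigma>" using LIMSEQ_le_const[OF s(2)] s(1) by blast
  have \<alpha>': "0 \<le> \<alpha>'" using LIMSEQ_le_const[OF \<alpha>(2)] \<alpha>(1) by blast
  \<comment> \<open>\<open>u n\<close> and \<open>\<tau> n\<close> stay in compact sets and
    \<open>x n = u n / \<tau> n\<close>; escape to infinity means that \<open>\<tau> n\<close> tends
    to 0.\<close>
  define \<tau> where "\<tau> n = 1 / (1 + norm (x n))" for n
  define u where "u n = \<tau> n *\<^sub>R x n" for n
  have \<tau>: "0 < \<tau> n" "\<tau> n \<le> 1" for n by (auto simp: \<tau>_def add_pos_nonneg)
  have x: "x n = (1 / \<tau> n) *\<^sub>R u n" for n using \<tau>(1)[of n] by (simp add: u_def)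
  have nu: "norm (u n) = 1 - \<tau> n" for n
    using \<tau>(1)[of n] add_pos_nonneg[of 1 "norm (x n)"] by (simp add: u_def \<tau>_def field_simps)
  have "bounded (range (\<lambda>n. (u n, \<tau> n)))"
  proof (rule bounded_subset)
    show "bounded (cball (0 :: real^'n) 1 \<times> cball (0 :: real) 1)"
      by (intro bounded_Times) auto
    show "range (\<lambda>n. (u n, \<tau> n)) \<subseteq> cball 0 1 \<times> cball 0 1"
      using \<tau> nu by (auto simp: less_imp_le)
  qed
  then obtain l j where j: "strict_mono j" "((\<lambda>n. (u n, \<tau> n)) \<circ> j) \<longlonglongrightarrow> l"
    using bounded_imp_convergent_subsequence by blast
  obtain u' \<tau>' where l: "l = (u', \<tau>')" by (cases l)
  have u': "(\<lambda>n. u (j n)) \<longlonglongrightarrow> u'" and \<tau>': "(\<lambda>n. \<tau> (j n)) \<longlonglongrightarrow> \<tau>'"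
    using tendsto_fst[OF j(2)] tendsto_snd[OF j(2)] by (simp_all add: l comp_def)
  have sub: "(\<lambda>n. s (j n)) \<longlonglongrightarrow> \<sigma>" "(\<lambda>n. \<alpha> (j n)) \<longlonglongrightarrow> \<alpha>'" "(\<lambda>n. A (j n)) \<longlonglongrightarrow> A'" "(\<lambda>n. b (j n)) \<longlonglongrightarrow> b'"
    using s(2) \<alpha>(2) A(1) b j(1) by (auto dest: LIMSEQ_subseq_LIMSEQ simp: comp_def)
  show ?thesis
  proof (cases "\<tau>' = 0")
    case False
    have x': "(\<lambda>n. x (j n)) \<longlonglongrightarrow> (1 / \<tau>') *\<^sub>R u'"
      unfolding x using False by (intro tendsto_intros u' \<tau>')
    have "(\<lambda>n. ell (s (j n)) (\<alpha> (j n)) (A (j n)) (b (j n)) (x (j n))) \<longlonglongrightarrow> ell \<sigma> \<alpha>' A' b' ((1 / \<tau>') *\<^sub>R u')"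
      by (intro tendsto_ell sub s x')
    moreover have "(\<lambda>n. ell \<sigma> \<alpha>' A' b' (x (j n))) \<longlonglongrightarrow> ell \<sigma> \<alpha>' A' b' ((1 / \<tau>') *\<^sub>R u')"
      by (intro tendsto_ell tendsto_const x' \<sigma>)
    ultimately show ?thesis using that j(1) by blast
  next
    case True
    have "(\<lambda>n. norm (u (j n))) \<longlonglongrightarrow> 1"
      unfolding nu using tendsto_diff[OF tendsto_const \<tau>', of 1] True by simp
    then have "norm u' = 1" using tendsto_norm[OF u'] LIMSEQ_unique by blast
    then have "u' \<noteq> 0" by auto
    then have pos: "0 < norm (A' *v u')"
      using inj_matrix_vector_mult[OF A(2)] by (metis inj_eq matrix_vector_mult_0_right zero_less_norm_iff)
    have inv: "filterlim (\<lambda>n. inverse (\<tau> (j n))) at_top sequentially"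
      using \<tau>' True \<tau>(1) by (intro filterlim_inverse_at_top) auto
    \<comment> \<open>Stated for arbitrary sequences with these limits, to serve both the moving and
      the constant parameters. The idea is \<open>B x + c = (B u + \<tau> c) / \<tau>\<close>, whose
      numerator has a nonzero limit.\<close>
    have esc: "filterlim (\<lambda>n. norm (B n *v x (j n) + c n)) at_top sequentially"
      if B: "B \<longlonglongrightarrow> A'" and c: "c \<longlonglongrightarrow> b'" for B c
    proof -
      have "(\<lambda>n. norm (B n *v u (j n) + \<tau> (j n) *\<^sub>R c n)) \<longlonglongrightarrow> norm (A' *v u' + \<tau>' *\<^sub>R b')"
        by (intro tendsto_intros tendsto_matrix_vector_mult B c u' \<tau>')
      then have "(\<lambda>n. norm (B n *v u (j n) + \<tau> (j n) *\<^sub>R c n)) \<longlonglongrightarrow> norm (A' *v u')"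
        using True by simp
      then have "filterlim (\<lambda>n. norm (B n *v u (j n) + \<tau> (j n) *\<^sub>R c n) * inverse (\<tau> (j n))) at_top sequentially"
        using pos inv by (rule filterlim_tendsto_pos_mult_at_top)
      moreover have "norm (B n *v u (j n) + \<tau> (j n) *\<^sub>R c n) * inverse (\<tau> (j n)) = norm (B n *v x (j n) + c n)" for n
      proof -
        have "B n *v u (j n) + \<tau> (j n) *\<^sub>R c n = \<tau> (j n) *\<^sub>R (B n *v x (j n) + c n)"
          by (simp add: u_def matrix_vector_mult_scaleR scaleR_add_right)
        then show ?thesis using \<tau>(1)[of "j n"] by simp
      qed
      ultimately show ?thesis by simp
    qed
    have "(\<lambda>n. ell (s (j n)) (\<alpha> (j n)) (A (j n)) (b (j n)) (x (j n))) \<longlonglongrightarrow> 0"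
      by (intro ell_tendsto_zero[where \<sigma> = \<sigma> and \<alpha>' = \<alpha>'] esc sub s \<alpha>)
    moreover have "(\<lambda>n. ell \<sigma> \<alpha>' A' b' (x (j n))) \<longlonglongrightarrow> 0"
      by (intro ell_tendsto_zero[where \<sigma> = \<sigma> and \<alpha>' = \<alpha>'] esc tendsto_const \<sigma> \<alpha>')
    ultimately show ?thesis using that j(1) by blast
  qed
qed

theorem theorem1p3:
  fixes f :: "real^'n \<Rightarrow> real"
  assumes "\<forall>x. 0 \<le> f x"
    and "upper_semicontinuous f"
    and "log_concave f"
    and "integrable lborel f"
    and "0 < (\<integral>x. f x \<partial>lborel)"
  shows "uniform_limit UNIV (\<lambda>s. Loewner s f) (Loewner 0 f) (at_right 0)"
proof (rule uniform_limitI)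
  fix \<epsilon> :: real assume \<epsilon>: "0 < \<epsilon>"
  have nonneg: "\<And>x. 0 \<le> f x" using assms(1) by blast
  note ex_opt = exists_optimal[OF nonneg assms(2-5)]
  obtain \<alpha>\<^sub>0 A\<^sub>0 b\<^sub>0 where opt0: "optimal 0 f \<alpha>\<^sub>0 A\<^sub>0 b\<^sub>0" using ex_opt[of 0] by auto
  obtain x\<^sub>0 r e where ball: "0 < r" "0 < e" "\<And>x. x \<in> cball x\<^sub>0 r \<Longrightarrow> e \<le> f x"
    by (rule log_concave_superlevel_cball[OF nonneg assms(3-5)], rule that)
  show "\<forall>\<^sub>F s in at_right 0. \<forall>x\<in>UNIV. dist (Loewner s f x) (Loewner 0 f x) < \<epsilon>"
  \<comment> \<open>The 1 is an arbitrary right end of the interval. Failure along a sequence gives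
    a subsequence with bad points \<open>x n\<close>.\<close>
  proof (rule sequentially_imp_eventually_at_right[of 0 1], simp, rule ccontr)
    fix s :: "nat \<Rightarrow> real"
    assume s: "\<And>n. 0 < s n" "s \<longlonglongrightarrow> 0"
      and bad: "\<not> (\<forall>\<^sub>F n in sequentially. \<forall>x\<in>UNIV. dist (Loewner (s n) f x) (Loewner 0 f x) < \<epsilon>)"
    obtain q :: "nat \<Rightarrow> nat" where q: "strict_mono q"
      "\<forall>n. \<not> (\<forall>x\<in>UNIV. dist (Loewner (s (q n)) f x) (Loewner 0 f x) < \<epsilon>)"
      using not_eventually_sequentiallyD[OF bad] by blast
    define t where "t n = s (q n)" for n
    have t: "0 \<le> t n" for n using s(1) by (simp add: t_def less_imp_le)
    have t_lim: "t \<longlonglongrightarrow> 0"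
      using LIMSEQ_subseq_LIMSEQ[OF s(2) q(1)] by (simp add: t_def[abs_def] comp_def)
    have "\<exists>x. \<epsilon> \<le> dist (Loewner (t n) f x) (Loewner 0 f x)" for n
      using q(2) by (auto simp: t_def not_less)
    then obtain x where x: "\<And>n. \<epsilon> \<le> dist (Loewner (t n) f (x n)) (Loewner 0 f (x n))" by metis
    obtain \<alpha> A b where opt: "\<And>n. optimal (t n) f (\<alpha> n) (A n) (b n)" using ex_opt[OF t] by metis
    then have fe: "feasible (t n) f (\<alpha> n) (A n) (b n)" for n by (simp add: optimal_def)
    \<comment> \<open>The optimal parameters for \<open>s = 0\<close> are feasible for
      \<open>t n\<close>, so they bound the optimal value there.\<close>
    have le: "\<alpha> n / \<bar>det (A n)\<bar> \<le> \<alpha>\<^sub>0 / \<bar>det A\<^sub>0\<bar>" for n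
      using opt[of n] feasible_zero_imp_feasible[OF t[of n]] opt0 unfolding optimal_def by blast
    obtain k \<alpha>' A' b' where k: "strict_mono k" "(\<alpha> \<circ> k) \<longlonglongrightarrow> \<alpha>'" "(A \<circ> k) \<longlonglongrightarrow> A'" "(b \<circ> k) \<longlonglongrightarrow> b'"
      and fe': "feasible 0 f \<alpha>' A' b'"
      by (rule feasible_subsequence[of r e x\<^sub>0 f t 0 \<alpha> A b, OF ball t t_lim fe le], assumption, rule that)
    have A': "invertible A'" using fe' by (simp add: feasible_def)
    \<comment> \<open>The limit is feasible for \<open>s = 0\<close> and its value does not exceed
      the optimum, so it is optimal.\<close>
    have "\<alpha>' / \<bar>det A'\<bar> \<le> \<alpha>\<^sub>0 / \<bar>det A\<^sub>0\<bar>"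
      using LIMSEQ_le_const2[OF feasible_value_tendsto[OF k(2,3) A']] le by auto
    then have opt': "optimal 0 f \<alpha>' A' b'"
      using opt0 fe' unfolding optimal_def by (blast intro: order_trans)
    obtain j L where j: "strict_mono j"
      "(\<lambda>n. ell ((t \<circ> k) (j n)) ((\<alpha> \<circ> k) (j n)) ((A \<circ> k) (j n)) ((b \<circ> k) (j n)) ((x \<circ> k) (j n))) \<longlonglongrightarrow> L"
      "(\<lambda>n. ell 0 \<alpha>' A' b' ((x \<circ> k) (j n))) \<longlonglongrightarrow> L"
    proof (rule ell_common_limit[where s = "t \<circ> k" and \<alpha> = "\<alpha> \<circ> k" and x = "x \<circ> k"])
      show "(t \<circ> k) \<longlonglongrightarrow> 0" using t_lim k(1) by (rule LIMSEQ_subseq_LIMSEQ)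
      show "0 \<le> (\<alpha> \<circ> k) n" for n using fe[of "k n"] by (simp add: feasible_def)
    qed (use t k A' in auto)
    \<comment> \<open>Both Loewner functions are evaluated through optimal parameters; by uniqueness
      the limit parameters represent \<open>Loewner 0 f\<close>, whichever subsequence was
      chosen.\<close>
    have "(\<lambda>n. dist (Loewner (t (k (j n))) f (x (k (j n)))) (Loewner 0 f (x (k (j n))))) \<longlonglongrightarrow> dist L L"
      using tendsto_dist[OF j(2,3)] Loewner_eq_ell[OF t opt] Loewner_eq_ell[OF order_refl opt'] by simp
    then have "\<epsilon> \<le> dist L L" by (rule LIMSEQ_le_const) (use x in auto)
    then show False using \<epsilon> by simp
  qed
qed

end
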